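(* Let $T>0$, $R_Y>0$, $R_Z>0$, $Y=\{y\in\mathbb R^2:\|y\|\le R_Y\}$, $Z=\{z\in\mathbb R^2:\|z\|\le R_Z\}$. Let $F:[0,T]\times\mathbb H\times Y\times Z\to\mathbb R$ be uniformly continuous and suppose there are constants $C_1,C_1'$ such that $|F(t,x,y,z)|\le C_1$ and $|F(t,x,y,z)-F(t,x',y,z)|\le C_1'\,d_G(x,x')$ for all $t\in[0,T]$, $x,x'\in\mathbb H$, $y\in Y$, $z\in Z$. Let $g:\mathbb H\to\mathbb R$ and suppose there are constants $C_2,C_2'$ such that $|g(x)|\le C_2$ and $|g(x)-g(x')|\le C_2'\,d_G(x,x')$ for all $x,x'\in\mathbb H$. Let $V^-$ be the lower value function of the zero-sum game with data $(T,Y,Z,F,g)$, and let $$H^-(t,x,\lambda)=\max_{y\in Y}\min_{z\in Z}\bigl(F(t,x,y,z)-\lambda\cdot z\bigr),\qquad (t,x,\lambda)\in[0,T]\times\mathbb H\times\mathbb R^2.$$ Then $V^-$ is a viscosity solution of $$\begin{cases}\dfrac{\partial u}{\partial t}(t,x)+H^-(t,x,\nabla_H u(t,x))=0 & \text{for }(t,x)\in(0,T)\times\mathbb H,\\ u(T,x)=g(x)&\text{for }x\in\mathbb H.\end{cases}$$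
   Context: $\|\cdot\|$ is the Euclidean norm. The Heisenberg group $\mathbb H$ is $\mathbb R^3$ with the group law $(x_1,x_2,x_3)\circ(x_1',x_2',x_3')=(x_1+x_1',x_2+x_2',x_3+x_3'+\tfrac12(x_1x_2'-x_1'x_2))$, so $(x_1,x_2,x_3)^{-1}=(-x_1,-x_2,-x_3)$. The Korányi gauge is $\|x\|_G=\left((x_1^2+x_2^2)^2+x_3^2\right)^{1/4}$ and $d_G(x,x')=\|(x')^{-1}\circ x\|_G$. The horizontal vector fields are $X_1=\partial_{x_1}-\frac{x_2}{2}\partial_{x_3}$, $X_2=\partial_{x_2}+\frac{x_1}{2}\partial_{x_3}$, and $\nabla_H u=(X_1u,X_2u)\in\mathbb R^2$. Set $f^{\mathbb H}(x,z)=\left(z_1,\ z_2,\ \tfrac12(z_2x_1-z_1x_2)\right)$. For measurable bounded $z:[a,b]\to\mathbb R^2$ and $\xi\in\mathbb H$, the horizontal curve on $[a,b]$ with horizontal velocity $z$ and initial point $\xi$ is the absolutely continuous curve with $x(t)=\xi+\int_a^t f^{\mathbb H}(x(s),z(s))\,ds$ for all $t\in[a,b]$. For $\tau\in[0,T]$: $\mathcal Y(\tau)$ is the set of measurable $y:[\tau,T]\to Y$ and $\mathcal Z(\tau)$ the set of measurable $z:[\tau,T]\to Z$. $\mathcal S_\beta(\tau)$ is the set of nonanticipative maps $\beta:\mathcal Y(\tau)\to\mathcal Z(\tau)$, i.e. such that for all $t\in[\tau,T]$ and $y,y'\in\mathcal Y(\tau)$ with $y=y'$ a.e. in $[\tau,t]$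 one has $\beta[y]=\beta[y']$ a.e. in $[\tau,t]$. The lower value function $V^-:[0,T]\times\mathbb H\to\mathbb R$ is $$V^-(\tau,\xi)=\inf_{\beta\in\mathcal S_\beta(\tau)}\ \sup_{y\in\mathcal Y(\tau)}\left\{\int_\tau^T F(t,x(t),y(t),\beta[y](t))\,dt+g(x(T))\right\},$$ where $x$ is the horizontal curve on $[\tau,T]$ with horizontal velocity $-\beta[y]$ and initial point $\xi$. Viscosity solution (terminal-value problem). A function $\psi:(0,T)\times\mathbb H\to\mathbb R$ is in $\Gamma^1((0,T)\times\mathbb H)$ if $(t,x)\mapsto(\partial_t\psi,X_1\psi,X_2\psi)(t,x)$ is continuous. Let $\mathcal H:[0,T]\times\mathbb H\times\mathbb R^2\to\mathbb R$ be continuous and $u:[0,T]\times\mathbb H\to\mathbb R$ be bounded and uniformly continuous with $u(T,x)=g(x)$ for $x\in\mathbb H$. Then $u$ is a viscosity subsolution of $\partial_tu+\mathcal H(t,x,\nabla_Hu)=0$ in $(0,T)\times\mathbb H$, $u(T,\cdot)=g$, if whenever $(t_0,x_0)\in(0,T)\times\mathbb H$ and $\psi\in\Gamma^1((0,T)\times\mathbb H)$ satisfy $u(t_0,x_0)=\psi(t_0,x_0)$ and $u\le\psi$ in a neighborhood of $(t_0,x_0)$, one has $\partial_t\psi(t_0,x_0)+\mathcal H(t_0,x_0,\nabla_H\psi(t_0,x_0))\ge0$. It is a viscosity supersolution if whenever $u(t_0,x_0)=\psi(t_0,x_0)$ and $u\ge\psi$ in a neighborhood of $(t_0,x_0)$,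 one has $\partial_t\psi(t_0,x_0)+\mathcal H(t_0,x_0,\nabla_H\psi(t_0,x_0))\le0$. A viscosity solution is both. *)

theory Defs
  imports "HOL-Analysis.Analysis"
begin

section \<open>The Heisenberg group\<close>

type_synonym heis = "real^3"

definition hmul :: "heis \<Rightarrow> heis \<Rightarrow> heis" where
  "hmul x x' = vector [x$1 + x'$1, x$2 + x'$2, x$3 + x'$3 + (x$1 * x'$2 - x'$1 * x$2) / 2]"

definition hinv :: "heis \<Rightarrow> heis" where
  "hinv x = vector [- x$1, - x$2, - x$3]"

definition koranyi :: "heis \<Rightarrow> real" where
  "koranyi x = root 4 (((x$1)\<^sup>2 + (x$2)\<^sup>2)\<^sup>2 + (x$3)\<^sup>2)"

definition dG :: "heis \<Rightarrow> heis \<Rightarrow> real" where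
  "dG x x' = koranyi (hmul (hinv x') x)"

definition X1 :: "heis \<Rightarrow> heis" where
  "X1 x = vector [1, 0, - x$2 / 2]"

definition X2 :: "heis \<Rightarrow> heis" where
  "X2 x = vector [0, 1, x$1 / 2]"

text \<open>A vector field acts on functions by differentiation along its integral curves. For
  \<open>X1\<close> and \<open>X2\<close> these are the straight lines \<open>s \<mapsto> x + s X(x)\<close>, because \<open>x$2\<close> is constant along
  \<open>X1\<close> and \<open>x$1\<close> is constant along \<open>X2\<close>. No derivative in the third variable alone is required.\<close>

definition along :: "(heis \<Rightarrow> heis) \<Rightarrow> (heis \<Rightarrow> real) \<Rightarrow> heis \<Rightarrow> real \<Rightarrow> real" where
  "along X u x = (\<lambda>s. u (x + s *\<^sub>R X x))"

definition grad_H :: "(heis \<Rightarrow> real) \<Rightarrow> heis \<Rightarrow> real^2" where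
  "grad_H u x = vector [deriv (along X1 u x) 0, deriv (along X2 u x) 0]"

text \<open>Uniform continuity of a real function on \<open>S\<close> with respect to an explicitly given distance.
  It is needed because \<open>dG\<close> and the Euclidean distance of \<^typ>\<open>heis\<close> induce the same topology but
  different uniformities.\<close>

definition unif_cont_wrt :: "('a \<Rightarrow> 'a \<Rightarrow> real) \<Rightarrow> 'a set \<Rightarrow> ('a \<Rightarrow> real) \<Rightarrow> bool" where
  "unif_cont_wrt d S f \<longleftrightarrow>
     (\<forall>\<epsilon>>0. \<exists>\<delta>>0. \<forall>p\<in>S. \<forall>q\<in>S. d p q < \<delta> \<longrightarrow> \<bar>f p - f q\<bar> < \<epsilon>)"

definition dist_tx :: "real \<times> heis \<Rightarrow> real \<times> heis \<Rightarrow> real" where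
  "dist_tx = (\<lambda>(t, x) (t', x'). \<bar>t - t'\<bar> + dG x x')"

definition dist_txyz ::
  "real \<times> heis \<times> (real^2) \<times> (real^2) \<Rightarrow> real \<times> heis \<times> (real^2) \<times> (real^2) \<Rightarrow> real" where
  "dist_txyz = (\<lambda>(t, x, y, z) (t', x', y', z').
     \<bar>t - t'\<bar> + dG x x' + dist y y' + dist z z')"


section \<open>Horizontal curves\<close>

definition fH :: "heis \<Rightarrow> real^2 \<Rightarrow> heis" where
  "fH x z = vector [z$1, z$2, (z$2 * x$1 - z$1 * x$2) / 2]"

definition abs_cont_curve :: "real \<Rightarrow> real \<Rightarrow> (real \<Rightarrow> 'a::real_normed_vector) \<Rightarrow> bool" where
  "abs_cont_curve a b x \<longleftrightarrow>
     (\<forall>\<epsilon>>0. \<exists>\<delta>>0. \<forall>(n::nat) c d.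
        (\<forall>i<n. a \<le> c i \<and> c i \<le> d i \<and> d i \<le> b) \<and>
        disjoint_family_on (\<lambda>i. {c i<..<d i}) {..<n} \<and>
        (\<Sum>i<n. d i - c i) < \<delta>
        \<longrightarrow> (\<Sum>i<n. norm (x (d i) - x (c i))) < \<epsilon>)"

definition is_horizontal_curve ::
  "real \<Rightarrow> real \<Rightarrow> (real \<Rightarrow> real^2) \<Rightarrow> heis \<Rightarrow> (real \<Rightarrow> heis) \<Rightarrow> bool" where
  "is_horizontal_curve a b z \<xi> x \<longleftrightarrow>
     abs_cont_curve a b x \<and>
     (\<forall>t\<in>{a..b}. x t = \<xi> + set_lebesgue_integral lebesgue {a..t} (\<lambda>s. fH (x s) (z s)))"

text \<open>Extensionality fixes the values outside \<open>{a..b}\<close>, so that the description is unique.\<close>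

definition horizontal_curve ::
  "real \<Rightarrow> real \<Rightarrow> (real \<Rightarrow> real^2) \<Rightarrow> heis \<Rightarrow> real \<Rightarrow> heis" where
  "horizontal_curve a b z \<xi> =
     (THE x. x \<in> extensional {a..b} \<and> is_horizontal_curve a b z \<xi> x)"


section \<open>The game\<close>

text \<open>Controls on \<open>[\<tau>,T]\<close> are total functions of which only the restriction to \<open>[\<tau>,T]\<close> matters. A
  nonanticipative map cannot exploit the values outside: for \<open>t = T\<close> the condition makes \<open>\<beta> y\<close>
  depend, up to a null set, only on \<open>y\<close> restricted to \<open>[\<tau>,T]\<close>.\<close>

definition controls :: "real \<Rightarrow> (real^2) set \<Rightarrow> real \<Rightarrow> (real \<Rightarrow> real^2) set" where
  "controls T A \<tau> = {y. y \<in> borel_measurable (lebesgue_on {\<tau>..T}) \<and> (\<forall>t\<in>{\<tau>..T}. y t \<in> A)}"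

definition strategies ::
  "real \<Rightarrow> (real^2) set \<Rightarrow> (real^2) set \<Rightarrow> real \<Rightarrow> ((real \<Rightarrow> real^2) \<Rightarrow> (real \<Rightarrow> real^2)) set" where
  "strategies T Y Z \<tau> =
     {\<beta>. (\<forall>y\<in>controls T Y \<tau>. \<beta> y \<in> controls T Z \<tau>) \<and>
         (\<forall>t\<in>{\<tau>..T}. \<forall>y\<in>controls T Y \<tau>. \<forall>y'\<in>controls T Y \<tau>.
            (AE s in lebesgue_on {\<tau>..t}. y s = y' s) \<longrightarrow>
            (AE s in lebesgue_on {\<tau>..t}. \<beta> y s = \<beta> y' s))}"

definition payoff ::
  "real \<Rightarrow> (real \<Rightarrow> heis \<Rightarrow> real^2 \<Rightarrow> real^2 \<Rightarrow> real) \<Rightarrow> (heis \<Rightarrow> real) \<Rightarrow>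
   real \<Rightarrow> heis \<Rightarrow> (real \<Rightarrow> real^2) \<Rightarrow> (real \<Rightarrow> real^2) \<Rightarrow> real" where
  "payoff T F g \<tau> \<xi> y z =
     (let x = horizontal_curve \<tau> T (\<lambda>t. - z t) \<xi>
      in set_lebesgue_integral lebesgue {\<tau>..T} (\<lambda>t. F t (x t) (y t) (z t)) + g (x T))"

definition lower_value ::
  "real \<Rightarrow> (real^2) set \<Rightarrow> (real^2) set \<Rightarrow> (real \<Rightarrow> heis \<Rightarrow> real^2 \<Rightarrow> real^2 \<Rightarrow> real) \<Rightarrow>
   (heis \<Rightarrow> real) \<Rightarrow> real \<Rightarrow> heis \<Rightarrow> real" where
  "lower_value T Y Z F g \<tau> \<xi> =
     (INF \<beta>\<in>strategies T Y Z \<tau>. SUP y\<in>controls T Y \<tau>. payoff T F g \<tau> \<xi> y (\<beta> y))"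

text \<open>Maximum and minimum of a function over a possibly infinite set; these are attained values
  and not merely the supremum and infimum.\<close>

definition max_over :: "'a set \<Rightarrow> ('a \<Rightarrow> real) \<Rightarrow> real" where
  "max_over A f = (GREATEST m. m \<in> f ` A)"

definition min_over :: "'a set \<Rightarrow> ('a \<Rightarrow> real) \<Rightarrow> real" where
  "min_over A f = (LEAST m. m \<in> f ` A)"

definition lower_hamiltonian ::
  "(real^2) set \<Rightarrow> (real^2) set \<Rightarrow> (real \<Rightarrow> heis \<Rightarrow> real^2 \<Rightarrow> real^2 \<Rightarrow> real) \<Rightarrow>
   real \<Rightarrow> heis \<Rightarrow> real^2 \<Rightarrow> real" where
  "lower_hamiltonian Y Z F t x p = max_over Y (\<lambda>y. min_over Z (\<lambda>z. F t x y z - p \<bullet> z))"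


section \<open>Viscosity solutions of the terminal-value problem\<close>

text \<open>Only the values of \<open>\<psi>\<close> on \<open>(0,T) \<times> heis\<close> are relevant here, since \<open>(0,T)\<close> is open.\<close>

definition Gamma1 :: "real \<Rightarrow> (real \<Rightarrow> heis \<Rightarrow> real) \<Rightarrow> bool" where
  "Gamma1 T \<psi> \<longleftrightarrow>
     (\<forall>t\<in>{0<..<T}. \<forall>x.
        (\<lambda>s. \<psi> s x) field_differentiable (at t) \<and>
        along X1 (\<psi> t) x field_differentiable (at 0) \<and>
        along X2 (\<psi> t) x field_differentiable (at 0)) \<and>
     continuous_on ({0<..<T} \<times> UNIV) (\<lambda>(t, x). (deriv (\<lambda>s. \<psi> s x) t, grad_H (\<psi> t) x))"

text \<open>The standing requirements on the Hamiltonian and on the candidate solution.\<close>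

definition admissible ::
  "real \<Rightarrow> (real \<Rightarrow> heis \<Rightarrow> real^2 \<Rightarrow> real) \<Rightarrow> (heis \<Rightarrow> real) \<Rightarrow> (real \<Rightarrow> heis \<Rightarrow> real) \<Rightarrow> bool"
  where
  "admissible T \<H> g u \<longleftrightarrow>
     continuous_on ({0..T} \<times> UNIV \<times> UNIV) (\<lambda>(t, x, p). \<H> t x p) \<and>
     bounded ((\<lambda>(t, x). u t x) ` ({0..T} \<times> UNIV)) \<and>
     unif_cont_wrt dist_tx ({0..T} \<times> UNIV) (\<lambda>(t, x). u t x) \<and>
     (\<forall>x. u T x = g x)"

definition viscosity_subsolution ::
  "real \<Rightarrow> (real \<Rightarrow> heis \<Rightarrow> real^2 \<Rightarrow> real) \<Rightarrow> (heis \<Rightarrow> real) \<Rightarrow> (real \<Rightarrow> heis \<Rightarrow> real) \<Rightarrow> bool"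
  where
  "viscosity_subsolution T \<H> g u \<longleftrightarrow>
     admissible T \<H> g u \<and>
     (\<forall>t0\<in>{0<..<T}. \<forall>x0 \<psi>.
        Gamma1 T \<psi> \<and> u t0 x0 = \<psi> t0 x0 \<and>
        (\<forall>\<^sub>F (t, x) in nhds (t0, x0). u t x \<le> \<psi> t x) \<longrightarrow>
        deriv (\<lambda>t. \<psi> t x0) t0 + \<H> t0 x0 (grad_H (\<psi> t0) x0) \<ge> 0)"

definition viscosity_supersolution ::
  "real \<Rightarrow> (real \<Rightarrow> heis \<Rightarrow> real^2 \<Rightarrow> real) \<Rightarrow> (heis \<Rightarrow> real) \<Rightarrow> (real \<Rightarrow> heis \<Rightarrow> real) \<Rightarrow> bool"
  where
  "viscosity_supersolution T \<H> g u \<longleftrightarrow>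
     admissible T \<H> g u \<and>
     (\<forall>t0\<in>{0<..<T}. \<forall>x0 \<psi>.
        Gamma1 T \<psi> \<and> u t0 x0 = \<psi> t0 x0 \<and>
        (\<forall>\<^sub>F (t, x) in nhds (t0, x0). u t x \<ge> \<psi> t x) \<longrightarrow>
        deriv (\<lambda>t. \<psi> t x0) t0 + \<H> t0 x0 (grad_H (\<psi> t0) x0) \<le> 0)"

definition viscosity_solution ::
  "real \<Rightarrow> (real \<Rightarrow> heis \<Rightarrow> real^2 \<Rightarrow> real) \<Rightarrow> (heis \<Rightarrow> real) \<Rightarrow> (real \<Rightarrow> heis \<Rightarrow> real) \<Rightarrow> bool"
  where
  "viscosity_solution T \<H> g u \<longleftrightarrow>
     viscosity_subsolution T \<H> g u \<and> viscosity_supersolution T \<H> g u"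

end

theory Submission
  imports Defs
begin

text \<open>Horizontal curves are explicit: the curve from \<open>\<xi>\<close> is the left translate by \<open>\<xi>\<close> of the curve
  from the identity, whose third coordinate is the swept area. Comparing the payoffs of two translates
  of one curve shows that the value function is uniformly continuous for \<open>dG\<close>, and concatenation of
  controls and strategies gives the dynamic programming principle. The viscosity inequalities follow
  from that principle on short intervals \<open>[t0, t0 + h]\<close>: for a subsolution, minimize with the strategy
  \<open>y \<mapsto> \<zeta>(y)\<close> for a Borel selection \<open>\<zeta>\<close> of nearly minimizing \<open>z\<close>; for a supersolution, maximize
  with a constant \<open>y\<close>. No chain rule along horizontal curves is needed: a test function in
  \<open>Gamma1\<close> has a first order expansion at each point with an error that is small compared to the
  gauge of the displacement.\<close>

section \<open>Horizontal curves in the Heisenberg group\<close>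

text \<open>A test function is only assumed differentiable in time and along the lines of
  \<open>X1\<close> and \<open>X2\<close>, while the direction of a trajectory changes measurably.
  The replacement for differentiating along the trajectory is static: dynamic programming evaluates
  \<open>\<psi>\<close> only at the end of a trajectory of duration \<open>h\<close>, whose
  displacement \<open>w\<close> from \<open>x0\<close> has gauge at most \<open>2 * RZ * h\<close>,
  so an expansion at the single point \<open>(t0, x0)\<close> with error of order
  \<open>\<epsilon> * h\<close> suffices. Its linear term \<open>p$1 * w$1 + p$2 * w$2\<close> is
  exactly minus the integral of \<open>p \<bullet> z\<close>, because the velocity is
  \<open>- z\<close>; this produces the expression \<open>F - p \<bullet> z\<close> of the
  Hamiltonian.

  Two trajectories under one control are \<open>hmul \<xi> w\<close> and
  \<open>hmul \<xi>' w\<close>, whereas \<open>dG\<close> is invariant under left translations. The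
  Lipschitz bounds on \<open>F\<close> and \<open>g\<close> therefore yield a modulus of square root
  type for the value function.

  The maximum stands outside the minimum because a strategy may answer the present value of
  \<open>y\<close>: in the upper bound the reply depends on \<open>y\<close>, in the lower bound one
  \<open>y\<close> has to do well against every \<open>z\<close>.\<close>

lemma hmul_nth [simp]:
  "hmul x y $ 1 = x$1 + y$1" "hmul x y $ 2 = x$2 + y$2"
  "hmul x y $ 3 = x$3 + y$3 + (x$1 * y$2 - y$1 * x$2) / 2"
  by (simp_all add: hmul_def)

lemma hinv_nth [simp]: "hinv x $ 1 = - x$1" "hinv x $ 2 = - x$2" "hinv x $ 3 = - x$3"
  by (simp_all add: hinv_def)

lemma fH_nth [simp]:
  "fH x z $ 1 = z$1" "fH x z $ 2 = z$2" "fH x z $ 3 = (z$2 * x$1 - z$1 * x$2) / 2"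
  by (simp_all add: fH_def)

lemma heis_eq_iff: "(x::heis) = y \<longleftrightarrow> x$1 = y$1 \<and> x$2 = y$2 \<and> x$3 = y$3"
  by (simp add: vec_eq_iff forall_3)

lemma hmul_assoc: "hmul (hmul x y) z = hmul x (hmul y z)"
  by (simp add: heis_eq_iff field_simps)

lemma hmul_0 [simp]: "hmul x 0 = x" "hmul 0 x = x"
  by (simp_all add: heis_eq_iff)

lemma hmul_hinv_cancel [simp]: "hmul (hinv x) (hmul x y) = y"
  by (simp add: heis_eq_iff algebra_simps diff_divide_distrib add_divide_distrib)

lemma koranyi_nonneg [simp]: "0 \<le> koranyi x"
  by (simp add: koranyi_def)

lemma koranyi_power4: "koranyi x ^ 4 = ((x$1)\<^sup>2 + (x$2)\<^sup>2)\<^sup>2 + (x$3)\<^sup>2"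
  by (simp add: koranyi_def)

lemma koranyi_leI:
  assumes "((x$1)\<^sup>2 + (x$2)\<^sup>2)\<^sup>2 + (x$3)\<^sup>2 \<le> c ^ 4" "0 \<le> c"
  shows "koranyi x \<le> c"
  by (rule power_le_imp_le_base[of _ 3]) (use assms in \<open>simp_all add: koranyi_power4\<close>)

lemma koranyi_hinv [simp]: "koranyi (hinv x) = koranyi x"
  by (simp add: koranyi_def)

lemma koranyi_0 [simp]: "koranyi 0 = 0"
  by (simp add: koranyi_def)

lemma dG_nonneg [simp]: "0 \<le> dG x y"
  by (simp add: dG_def)

lemma dG_self [simp]: "dG x x = 0"
proof -
  have "hmul (hinv x) x = 0" by (simp add: heis_eq_iff)
  then show ?thesis by (simp add: dG_def)
qed

lemma dG_commute: "dG x y = dG y x"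
proof -
  have "hmul (hinv x) y = hinv (hmul (hinv y) x)"
    by (simp add: heis_eq_iff field_simps)
  then show ?thesis by (simp add: dG_def)
qed

lemma dG_hmul_right [simp]: "dG (hmul x w) x = koranyi w"
  by (simp add: dG_def)

text \<open>Each nonnegative summand of \<open>koranyi x ^ 4\<close> is at most the sum. The third
  coordinate has weight two: it is of second order in the gauge.\<close>

lemma koranyi_coords:
  "\<bar>x$1\<bar> \<le> koranyi x" "\<bar>x$2\<bar> \<le> koranyi x" "\<bar>x$3\<bar> \<le> (koranyi x)\<^sup>2"
proof -
  have sq: "((x$1)\<^sup>2 + (x$2)\<^sup>2)\<^sup>2 + (x$3)\<^sup>2 = ((koranyi x)\<^sup>2)\<^sup>2"
    by (simp add: koranyi_power4 flip: power_mult)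
  have "(x$1)\<^sup>2 + (x$2)\<^sup>2 \<le> (koranyi x)\<^sup>2"
  proof (rule power2_le_imp_le)
    show "((x$1)\<^sup>2 + (x$2)\<^sup>2)\<^sup>2 \<le> ((koranyi x)\<^sup>2)\<^sup>2"
      using sq zero_le_power2[of "x$3"] by linarith
  qed simp
  then have "(x$1)\<^sup>2 \<le> (koranyi x)\<^sup>2" "(x$2)\<^sup>2 \<le> (koranyi x)\<^sup>2"
    by (smt (verit) zero_le_power2)+
  then show "\<bar>x$1\<bar> \<le> koranyi x" "\<bar>x$2\<bar> \<le> koranyi x"
    using abs_le_square_iff[of "x$1" "koranyi x"] abs_le_square_iff[of "x$2" "koranyi x"] by auto
  have "(x$3)\<^sup>2 \<le> ((koranyi x)\<^sup>2)\<^sup>2"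
    using sq by (smt (verit) zero_le_power2)
  then show "\<bar>x$3\<bar> \<le> (koranyi x)\<^sup>2"
    using abs_le_square_iff[of "x$3" "(koranyi x)\<^sup>2"] by auto
qed

lemma continuous_on_koranyi: "continuous_on UNIV koranyi"
  unfolding koranyi_def[abs_def] by (intro continuous_intros)

lemma continuous_on_heisI:
  fixes f :: "'a::topological_space \<Rightarrow> heis"
  assumes "continuous_on S (\<lambda>x. f x $ 1)" "continuous_on S (\<lambda>x. f x $ 2)" "continuous_on S (\<lambda>x. f x $ 3)"
  shows "continuous_on S f"
proof -
  have "\<forall>i. continuous_on S (\<lambda>x. f x $ i)" using assms by (simp add: forall_3)
  then have "continuous_on S (\<lambda>x. \<chi> i. f x $ i)" by (intro continuous_on_vec_lambda) auto
  then show ?thesis by simp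
qed

lemma continuous_on_hmul [continuous_intros]:
  assumes "continuous_on S f" "continuous_on S g"
  shows "continuous_on S (\<lambda>x. hmul (f x) (g x))"
  by (rule continuous_on_heisI; simp; intro continuous_intros assms; simp)

text \<open>Right translation of a pair of points changes their distance only through the commutator
  term in the centre, whence the square root behaviour for \<open>d \<rightarrow> 0\<close>.\<close>

definition conj_mod :: "real \<Rightarrow> real \<Rightarrow> real" where
  "conj_mod M d = root 4 (4 * d ^ 4 + (d\<^sup>2 + 2 * M * d)\<^sup>2)"

lemma conj_mod_nonneg: "0 \<le> conj_mod M d"
  by (simp add: conj_mod_def)

lemma conj_mod_tendsto: "(conj_mod M \<longlongrightarrow> 0) (at_right 0)"
proof -
  have "(conj_mod M \<longlongrightarrow> root 4 (4 * 0 ^ 4 + (0\<^sup>2 + 2 * M * 0)\<^sup>2)) (at_right 0)"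
    unfolding conj_mod_def[abs_def] by (intro tendsto_intros)
  then show ?thesis by simp
qed

lemma conj_mod_mono:
  assumes "0 \<le> d" "d \<le> d'" "0 \<le> M"
  shows "conj_mod M d \<le> conj_mod M d'"
  unfolding conj_mod_def using assms
  by (intro real_root_le_mono add_mono mult_left_mono power_mono mult_mono) auto

text \<open>\<open>hmul (hinv (hmul y w)) (hmul x w)\<close> is
  \<open>\<eta> = hmul (hinv y) x\<close> conjugated by \<open>w\<close>. Conjugation fixes the
  first two coordinates and moves the third by \<open>\<eta>$1 * w$2 - w$1 * \<eta>$2\<close>, at
  most \<open>2 * M * d\<close> in absolute value.\<close>

lemma dG_hmul_hmul_le:
  assumes "\<bar>w$1\<bar> \<le> M" "\<bar>w$2\<bar> \<le> M"
  shows "dG (hmul x w) (hmul y w) \<le> conj_mod M (dG x y)"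
proof -
  define \<eta> where "\<eta> = hmul (hinv y) x"
  define d where "d = dG x y"
  have d: "d = koranyi \<eta>" by (simp add: d_def dG_def \<eta>_def)
  have M: "0 \<le> M" using assms by auto
  let ?v = "hmul (hinv (hmul y w)) (hmul x w)"
  have v: "?v$1 = \<eta>$1" "?v$2 = \<eta>$2" "?v$3 = \<eta>$3 + (\<eta>$1 * w$2 - w$1 * \<eta>$2)"
    by (simp_all add: \<eta>_def field_simps)
  note c = koranyi_coords[of \<eta>, folded d]
  have d0: "0 \<le> d" by (simp add: d)
  have "\<bar>\<eta>$1 * w$2\<bar> \<le> d * M" "\<bar>w$1 * \<eta>$2\<bar> \<le> M * d"
    unfolding abs_mult using c assms by (auto intro: mult_mono d0 M)
  then have "\<bar>?v$3\<bar> \<le> d\<^sup>2 + 2 * M * d"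
    unfolding v using c by (simp add: algebra_simps)
  then have 3: "(?v$3)\<^sup>2 \<le> (d\<^sup>2 + 2 * M * d)\<^sup>2"
    by (metis abs_ge_zero power2_abs power_mono)
  have "(\<eta>$1)\<^sup>2 \<le> d\<^sup>2" "(\<eta>$2)\<^sup>2 \<le> d\<^sup>2"
    using c by (metis abs_ge_zero power2_abs power_mono)+
  then have "(\<eta>$1)\<^sup>2 + (\<eta>$2)\<^sup>2 \<le> 2 * d\<^sup>2" by simp
  then have "((\<eta>$1)\<^sup>2 + (\<eta>$2)\<^sup>2)\<^sup>2 \<le> (2 * d\<^sup>2)\<^sup>2" by (intro power_mono) auto
  also have "\<dots> = 4 * d ^ 4" by (simp add: power2_eq_square power4_eq_xxxx)
  finally have "((?v$1)\<^sup>2 + (?v$2)\<^sup>2)\<^sup>2 + (?v$3)\<^sup>2 \<le> 4 * d ^ 4 + (d\<^sup>2 + 2 * M * d)\<^sup>2"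
    using 3 unfolding v by linarith
  then show ?thesis
    unfolding dG_def[of "hmul x w"] koranyi_def conj_mod_def d_def[symmetric]
    by (intro real_root_le_mono) auto
qed

section \<open>Null sets and integrability on intervals\<close>

text \<open>Strategies are compared almost everywhere, integrals through
  \<open>integral_spike\<close>; negligible sets are the common language.\<close>

lemma AE_lebesgue_on_iff_negligible:
  assumes "S \<in> sets lebesgue"
  shows "(AE s in lebesgue_on S. P s) \<longleftrightarrow> negligible {s\<in>S. \<not> P s}"
proof -
  have "(AE s in lebesgue_on S. P s) \<longleftrightarrow> (AE s in lebesgue. s \<in> S \<longrightarrow> P s)"
    using assms by (simp add: AE_restrict_space_iff)
  also have "\<dots> \<longleftrightarrow> negligible {s\<in>S. \<not> P s}"
    by (auto simp: completion.AE_iff_null_sets negligible_iff_null_sets null_sets_completion_subset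
         intro!: arg_cong[where f="\<lambda>S. S \<in> null_sets lebesgue"])
  finally show ?thesis .
qed

lemma bounded_measurable_absolutely_integrable:
  fixes f :: "real \<Rightarrow> 'a::euclidean_space"
  assumes "f \<in> borel_measurable (lebesgue_on {a..b})" "\<And>t. t \<in> {a..b} \<Longrightarrow> norm (f t) \<le> B"
  shows "f absolutely_integrable_on {a..b}"
  by (rule measurable_bounded_by_integrable_imp_absolutely_integrable[where g="\<lambda>_. B"])
     (use assms in auto)

lemma absolutely_integrable_imp_integrable:
  fixes f :: "real \<Rightarrow> 'a::euclidean_space"
  shows "f absolutely_integrable_on S \<Longrightarrow> f integrable_on S"
  by (rule set_lebesgue_integral_eq_integral(1))

section \<open>The explicit curve from the identity\<close>

text \<open>The bound and the interval are parameters, so one predicate serves the controls of both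
  players, the velocity \<open>- z\<close>, and all restrictions and concatenations in time.\<close>

definition bdd_meas :: "real \<Rightarrow> real \<Rightarrow> real \<Rightarrow> (real \<Rightarrow> real^2) \<Rightarrow> bool" where
  "bdd_meas a b R z \<longleftrightarrow> z \<in> borel_measurable (lebesgue_on {a..b}) \<and> (\<forall>t\<in>{a..b}. norm (z t) \<le> R)"

text \<open>The horizontal equation is triangular: the first two coordinates are primitives of
  \<open>z\<close>, and the third is then a plain integral. The gauge integral is used for its
  calculus of indefinite integrals.\<close>

definition hcurve :: "real \<Rightarrow> (real \<Rightarrow> real^2) \<Rightarrow> real \<Rightarrow> heis" where
  "hcurve a z t = vector [integral {a..t} (\<lambda>s. z s $ 1), integral {a..t} (\<lambda>s. z s $ 2),
     integral {a..t} (\<lambda>s. z s $ 2 * integral {a..s} (\<lambda>r. z r $ 1) -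
                          z s $ 1 * integral {a..s} (\<lambda>r. z r $ 2)) / 2]"

lemma hcurve_nth:
  "hcurve a z t $ 1 = integral {a..t} (\<lambda>s. z s $ 1)"
  "hcurve a z t $ 2 = integral {a..t} (\<lambda>s. z s $ 2)"
  "hcurve a z t $ 3 = integral {a..t} (\<lambda>s. z s $ 2 * hcurve a z s $ 1 - z s $ 1 * hcurve a z s $ 2) / 2"
  by (simp_all add: hcurve_def)

lemma hcurve_start [simp]: "hcurve a z a = 0"
  by (simp add: heis_eq_iff hcurve_nth)

lemma bdd_meas_subset:
  assumes "bdd_meas a b R z" "{c..d} \<subseteq> {a..b}"
  shows "bdd_meas c d R z"
  using assms unfolding bdd_meas_def by (auto intro: measurable_restrict_mono)

lemma bdd_meas_uminus: "bdd_meas a b R z \<Longrightarrow> bdd_meas a b R (\<lambda>t. - z t)"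
  unfolding bdd_meas_def by auto

lemma bdd_meas_nth_bound:
  assumes "bdd_meas a b R z" "t \<in> {a..b}"
  shows "\<bar>z t $ i\<bar> \<le> R"
  using assms component_le_norm_cart[of "z t" i] unfolding bdd_meas_def by fastforce

lemma borel_measurable_vec_nth:
  assumes "z \<in> borel_measurable M"
  shows "(\<lambda>t. (z t :: real^'n) $ i) \<in> borel_measurable M"
  using borel_measurable_nth[of i] assms by (rule measurable_compose_rev)

lemma bdd_meas_nth_meas:
  assumes "bdd_meas a b R z"
  shows "(\<lambda>t. z t $ i) \<in> borel_measurable (lebesgue_on {a..b})"
  using assms unfolding bdd_meas_def by (auto intro: borel_measurable_vec_nth)

lemma bdd_meas_nth_mult_integrable:
  assumes "bdd_meas a b R z" "continuous_on {a..b} f"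
  shows "(\<lambda>t. z t $ i * f t) integrable_on {a..b}"
proof -
  obtain B where B: "\<And>t. t \<in> {a..b} \<Longrightarrow> norm (f t) \<le> B"
    using compact_imp_bounded[OF compact_continuous_image[OF assms(2) compact_Icc]]
    unfolding bounded_iff by blast
  show ?thesis
  proof (rule absolutely_integrable_imp_integrable, rule bounded_measurable_absolutely_integrable)
    show "(\<lambda>t. z t $ i * f t) \<in> borel_measurable (lebesgue_on {a..b})"
      using bdd_meas_nth_meas[OF assms(1), of i] continuous_imp_measurable_on_sets_lebesgue[OF assms(2)]
      by (intro borel_measurable_times) auto
    show "norm (z t $ i * f t) \<le> R * B" if "t \<in> {a..b}" for t
      using bdd_meas_nth_bound[OF assms(1) that, of i] B[OF that]
      by (simp add: abs_mult) (meson abs_ge_zero mult_mono' order_trans)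
  qed
qed

lemma bdd_meas_nth_integrable:
  assumes "bdd_meas a b R z"
  shows "(\<lambda>t. z t $ i) integrable_on {a..b}"
  using bdd_meas_nth_mult_integrable[OF assms, of "\<lambda>_. 1" i] by simp

lemma continuous_on_hcurve_nth:
  assumes "bdd_meas a b R z"
  shows "continuous_on {a..b} (\<lambda>t. hcurve a z t $ 1)" "continuous_on {a..b} (\<lambda>t. hcurve a z t $ 2)"
  unfolding hcurve_nth
  by (rule indefinite_integral_continuous_1[OF bdd_meas_nth_integrable[OF assms]])+

lemma hcurve_area_integrable:
  assumes "bdd_meas a b R z"
  shows "(\<lambda>s. z s $ 2 * hcurve a z s $ 1 - z s $ 1 * hcurve a z s $ 2) integrable_on {a..b}"
  by (intro integrable_diff bdd_meas_nth_mult_integrable[OF assms] continuous_on_hcurve_nth[OF assms])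

lemma continuous_on_hcurve:
  assumes "bdd_meas a b R z"
  shows "continuous_on {a..b} (hcurve a z)"
proof (rule continuous_on_heisI)
  show "continuous_on {a..b} (\<lambda>t. hcurve a z t $ 3)"
    unfolding hcurve_nth(3)
    by (intro continuous_intros indefinite_integral_continuous_1 hcurve_area_integrable[OF assms]) auto
qed (rule continuous_on_hcurve_nth[OF assms])+

text \<open>The inner integrals agree for every upper limit up to \<open>t\<close>, so the
  integrands of the third coordinate can differ only where \<open>z\<close> and \<open>z'\<close>
  do.\<close>

lemma hcurve_cong:
  assumes "AE s in lebesgue_on {a..t}. z s = z' s"
  shows "hcurve a z t = hcurve a z' t"
proof -
  let ?N = "{s\<in>{a..t}. z s \<noteq> z' s}"
  have N: "negligible ?N" using assms by (simp add: AE_lebesgue_on_iff_negligible)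
  have 1: "integral {a..s} (\<lambda>r. z r $ i) = integral {a..s} (\<lambda>r. z' r $ i)" if "s \<le> t" for s i
    by (rule integral_spike[OF N]) (use that in auto)
  show ?thesis
    unfolding heis_eq_iff hcurve_nth(1,2)
    by (intro conjI 1 order_refl, unfold hcurve_def, simp, rule integral_spike[OF N]) (auto simp: 1)
qed

text \<open>Chen's relation for a path and its area. Replacing the position measured from
  \<open>a\<close> by the one measured from \<open>c\<close> adds a term linear in \<open>z\<close>
  to the area integrand; its integral is the commutator term of the group law.\<close>

lemma hcurve_split:
  assumes z: "bdd_meas a b R z" and c: "a \<le> c" "c \<le> t" "t \<le> b"
  shows "hcurve a z t = hmul (hcurve a z c) (hcurve c z t)"
proof -
  have za: "bdd_meas a t R z" and zc: "bdd_meas c t R z"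
    by (rule bdd_meas_subset[OF z]; use c in auto)+
  have comb: "integral {a..s} (\<lambda>r. z r $ i) = integral {a..c} (\<lambda>r. z r $ i) + integral {c..s} (\<lambda>r. z r $ i)"
    if "s \<in> {c..t}" for s i
    by (rule Henstock_Kurzweil_Integration.integral_combine[symmetric])
       (use that c in \<open>auto intro: bdd_meas_nth_integrable[OF bdd_meas_subset[OF z, of a s]]\<close>)
  have w: "hcurve a z s $ 1 = hcurve a z c $ 1 + hcurve c z s $ 1"
          "hcurve a z s $ 2 = hcurve a z c $ 2 + hcurve c z s $ 2" if "s \<in> {c..t}" for s
    using comb[OF that] by (simp_all add: hcurve_nth)
  let ?A = "\<lambda>s. z s $ 2 * hcurve a z s $ 1 - z s $ 1 * hcurve a z s $ 2"
  let ?C = "\<lambda>s. z s $ 2 * hcurve c z s $ 1 - z s $ 1 * hcurve c z s $ 2"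
  have "integral {a..t} ?A = integral {a..c} ?A + integral {c..t} ?A"
    by (rule Henstock_Kurzweil_Integration.integral_combine[symmetric]) (use c hcurve_area_integrable[OF za] in auto)
  also have "integral {c..t} ?A = integral {c..t}
      (\<lambda>s. ?C s + (hcurve a z c $ 1 * z s $ 2 - hcurve a z c $ 2 * z s $ 1))"
  proof (rule integral_cong)
    fix s assume "s \<in> {c..t}"
    from w[OF this] show "?A s = ?C s + (hcurve a z c $ 1 * z s $ 2 - hcurve a z c $ 2 * z s $ 1)"
      by (simp only: algebra_simps)
  qed
  also have "\<dots> = integral {c..t} ?C + (hcurve a z c $ 1 * hcurve c z t $ 2 - hcurve a z c $ 2 * hcurve c z t $ 1)"
  proof (rule integral_unique, intro has_integral_add has_integral_diff has_integral_mult_right)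
    show "(?C has_integral integral {c..t} ?C) {c..t}"
      by (rule integrable_integral[OF hcurve_area_integrable[OF zc]])
  qed ((unfold hcurve_nth(1,2))?, intro integrable_integral bdd_meas_nth_integrable[OF zc])+
  finally have "2 * hcurve a z t $ 3 = 2 * hcurve a z c $ 3 + (2 * hcurve c z t $ 3
      + (hcurve a z c $ 1 * hcurve c z t $ 2 - hcurve a z c $ 2 * hcurve c z t $ 1))"
    unfolding hcurve_nth(3) by simp
  then have "hcurve a z t $ 3 = hmul (hcurve a z c) (hcurve c z t) $ 3"
    by (simp add: field_simps)
  then show ?thesis
    unfolding heis_eq_iff using c w[of t] by simp
qed

lemma integral_abs_le:
  fixes f :: "real \<Rightarrow> real"
  assumes "f integrable_on {a..b}" "\<And>t. t \<in> {a..b} \<Longrightarrow> \<bar>f t\<bar> \<le> B" "a \<le> b"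
  shows "\<bar>integral {a..b} f\<bar> \<le> B * (b - a)"
proof -
  have "norm (integral {a..b} f) \<le> integral {a..b} (\<lambda>_. B)"
    using assms by (intro integral_norm_bound_integral) auto
  then show ?thesis using assms(3) by (simp add: mult.commute)
qed

lemma hcurve_bounds:
  assumes z: "bdd_meas a b R z" and t: "t \<in> {a..b}"
  shows "\<bar>hcurve a z t $ 1\<bar> \<le> R * (t - a)" "\<bar>hcurve a z t $ 2\<bar> \<le> R * (t - a)"
    "\<bar>hcurve a z t $ 3\<bar> \<le> R\<^sup>2 * (t - a)\<^sup>2"
proof -
  have R: "0 \<le> R" using bdd_meas_nth_bound[OF z t, of 1] by linarith
  have *: "\<bar>hcurve a z s $ 1\<bar> \<le> R * (s - a)" "\<bar>hcurve a z s $ 2\<bar> \<le> R * (s - a)" if "s \<in> {a..b}" for s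
    unfolding hcurve_nth using that
    by (auto intro!: integral_abs_le bdd_meas_nth_integrable[OF bdd_meas_subset[OF z]] bdd_meas_nth_bound[OF z])
  show "\<bar>hcurve a z t $ 1\<bar> \<le> R * (t - a)" "\<bar>hcurve a z t $ 2\<bar> \<le> R * (t - a)"
    using *[OF t] by auto
  have "\<bar>integral {a..t} (\<lambda>s. z s $ 2 * hcurve a z s $ 1 - z s $ 1 * hcurve a z s $ 2)\<bar>
      \<le> 2 * R\<^sup>2 * (t - a) * (t - a)"
  proof (rule integral_abs_le)
    show "(\<lambda>s. z s $ 2 * hcurve a z s $ 1 - z s $ 1 * hcurve a z s $ 2) integrable_on {a..t}"
      using t by (intro hcurve_area_integrable[OF bdd_meas_subset[OF z]]) auto
    fix s assume s: "s \<in> {a..t}"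
    have "\<bar>z s $ 2 * hcurve a z s $ 1\<bar> \<le> R * (R * (t - a))" "\<bar>z s $ 1 * hcurve a z s $ 2\<bar> \<le> R * (R * (t - a))"
      unfolding abs_mult using s t R
      by (auto intro!: mult_mono bdd_meas_nth_bound[OF z] order_trans[OF *(1)] order_trans[OF *(2)] mult_left_mono)
    then show "\<bar>z s $ 2 * hcurve a z s $ 1 - z s $ 1 * hcurve a z s $ 2\<bar> \<le> 2 * R\<^sup>2 * (t - a)"
      by (simp add: power2_eq_square algebra_simps)
  qed (use t in auto)
  then show "\<bar>hcurve a z t $ 3\<bar> \<le> R\<^sup>2 * (t - a)\<^sup>2"
    unfolding hcurve_nth(3) by (simp add: power2_eq_square algebra_simps)
qed

text \<open>In time \<open>t - a\<close> the first two coordinates move by at most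
  \<open>R * (t - a)\<close> and the third by its square, so the gauge grows linearly in time. The
  factor 2 comes from the fourth powers: \<open>4 + 1 = 5 \<le> 16\<close>.\<close>

lemma koranyi_hcurve_le:
  assumes z: "bdd_meas a b R z" and t: "t \<in> {a..b}"
  shows "koranyi (hcurve a z t) \<le> 2 * R * (t - a)"
proof (rule koranyi_leI)
  let ?w = "hcurve a z t" and ?r = "R * (t - a)"
  have R: "0 \<le> R" using bdd_meas_nth_bound[OF z t, of 1] by linarith
  note b = hcurve_bounds[OF z t]
  have sq: "u\<^sup>2 \<le> v\<^sup>2" if "\<bar>u\<bar> \<le> v" for u v :: real
    using that by (metis abs_ge_zero power2_abs power_mono)
  have "(?w$1)\<^sup>2 \<le> ?r\<^sup>2" "(?w$2)\<^sup>2 \<le> ?r\<^sup>2" "(?w$3)\<^sup>2 \<le> (R\<^sup>2 * (t - a)\<^sup>2)\<^sup>2"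
    by (rule sq; rule b)+
  then have "((?w$1)\<^sup>2 + (?w$2)\<^sup>2)\<^sup>2 + (?w$3)\<^sup>2 \<le> (2 * ?r\<^sup>2)\<^sup>2 + (R\<^sup>2 * (t - a)\<^sup>2)\<^sup>2"
    by (intro add_mono[OF power_mono]) auto
  also have "\<dots> = 5 * ?r ^ 4" by (simp add: power_mult_distrib flip: power_mult)
  also have "\<dots> \<le> 16 * ?r ^ 4" by (simp)
  also have "\<dots> = (2 * R * (t - a)) ^ 4" by (simp add: power_mult_distrib)
  finally show "((?w$1)\<^sup>2 + (?w$2)\<^sup>2)\<^sup>2 + (?w$3)\<^sup>2 \<le> (2 * R * (t - a)) ^ 4" .
  show "0 \<le> 2 * R * (t - a)" using R t by simp
qed

text \<open>Integrability identifies the Lebesgue integral in the definition of a horizontal curve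
  with the gauge integral; the bound \<open>B\<close> later serves as a Lipschitz constant of the
  curve.\<close>

lemma fH_absolutely_integrable:
  assumes z: "bdd_meas a b R z" and x: "continuous_on {a..b} x"
  obtains B where "\<And>t. t \<in> {a..b} \<Longrightarrow> norm (fH (x t) (z t)) \<le> B"
    and "(\<lambda>s. fH (x s) (z s)) absolutely_integrable_on {a..b}"
proof -
  obtain M where M: "\<And>t. t \<in> {a..b} \<Longrightarrow> norm (x t) \<le> M"
    using compact_imp_bounded[OF compact_continuous_image[OF x compact_Icc]]
    unfolding bounded_iff by blast
  define B where "B = R + R + R * M"
  have B: "norm (fH (x t) (z t)) \<le> B" if t: "t \<in> {a..b}" for t
  proof -
    note zb = bdd_meas_nth_bound[OF z t]
    have R: "0 \<le> R" using zb[of 1] by linarith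
    have xb: "\<bar>x t $ i\<bar> \<le> M" for i
      using M[OF t] component_le_norm_cart[of "x t" i] by linarith
    have "\<bar>z t $ 2 * x t $ 1\<bar> \<le> R * M" "\<bar>z t $ 1 * x t $ 2\<bar> \<le> R * M"
      unfolding abs_mult by (intro mult_mono zb xb R abs_ge_zero)+
    then have "\<bar>fH (x t) (z t) $ 3\<bar> \<le> R * M" by simp
    moreover have "norm (fH (x t) (z t)) \<le> (\<Sum>i\<in>UNIV. \<bar>fH (x t) (z t) $ i\<bar>)"
      by (rule norm_le_l1_cart)
    ultimately show ?thesis
      using zb[of 1] zb[of 2] by (simp add: sum_3 B_def)
  qed
  have "continuous_on UNIV (\<lambda>p. fH (fst p) (snd p))"
    by (rule continuous_on_heisI)
       (simp_all add: continuous_on_component continuous_on_divide continuous_on_mult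
          continuous_on_diff continuous_on_fst continuous_on_snd)
  then have "(\<lambda>s. fH (x s) (z s)) \<in> borel_measurable (lebesgue_on {a..b})"
    using z continuous_imp_measurable_on_sets_lebesgue[OF x]
    by (intro borel_measurable_continuous_Pair[where f=x and g=z and H=fH])
       (auto simp: bdd_meas_def case_prod_unfold)
  then have "(\<lambda>s. fH (x s) (z s)) absolutely_integrable_on {a..b}"
    by (rule bounded_measurable_absolutely_integrable) (rule B)
  with B that show ?thesis by blast
qed

section \<open>Existence and uniqueness of horizontal curves\<close>

text \<open>One direction is existence, the other uniqueness. The first two components of the
  equation determine \<open>x$1\<close> and \<open>x$2\<close>; inserted into the third they give
  the area integral plus the commutator term with \<open>\<xi>\<close>.\<close>

lemma horizontal_equation_iff:
  assumes z: "bdd_meas a b R z" and x: "continuous_on {a..b} x"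
  shows "(\<forall>t\<in>{a..b}. x t = \<xi> + set_lebesgue_integral lebesgue {a..t} (\<lambda>s. fH (x s) (z s)))
     \<longleftrightarrow> (\<forall>t\<in>{a..b}. x t = hmul \<xi> (hcurve a z t))"
proof -
  have int: "set_lebesgue_integral lebesgue {a..t} (\<lambda>s. fH (x s) (z s)) $ i
     = integral {a..t} (\<lambda>s. fH (x s) (z s) $ i)" if "t \<in> {a..b}" for t i
  proof -
    have "bdd_meas a t R z" "continuous_on {a..t} x"
      using that by (auto intro: bdd_meas_subset[OF z] continuous_on_subset[OF x])
    from fH_absolutely_integrable[OF this]
    have "(\<lambda>s. fH (x s) (z s)) absolutely_integrable_on {a..t}" by blast
    from set_lebesgue_integral_eq_integral[OF this] show ?thesis by simp
  qed
  \<comment> \<open>Only the first two coordinates of \<open>x\<close> are assumed to be known, so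
    that the computation serves both directions.\<close>
  have 3: "integral {a..t} (\<lambda>s. (z s $ 2 * x s $ 1 - z s $ 1 * x s $ 2) / 2)
      = hcurve a z t $ 3 + (\<xi> $ 1 * hcurve a z t $ 2 - hcurve a z t $ 1 * \<xi> $ 2) / 2"
    if t: "t \<in> {a..b}" and eq: "\<And>s. s \<in> {a..t} \<Longrightarrow> x s $ 1 = \<xi> $ 1 + hcurve a z s $ 1"
       "\<And>s. s \<in> {a..t} \<Longrightarrow> x s $ 2 = \<xi> $ 2 + hcurve a z s $ 2" for t
  proof -
    have zt: "bdd_meas a t R z" by (rule bdd_meas_subset[OF z]) (use t in auto)
    let ?A = "\<lambda>s. z s $ 2 * hcurve a z s $ 1 - z s $ 1 * hcurve a z s $ 2"
    have "((\<lambda>s. ?A s + (\<xi> $ 1 * z s $ 2 - \<xi> $ 2 * z s $ 1)) has_integral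
       integral {a..t} ?A + (\<xi> $ 1 * hcurve a z t $ 2 - \<xi> $ 2 * hcurve a z t $ 1)) {a..t}"
    proof (intro has_integral_add has_integral_diff has_integral_mult_right)
      show "(?A has_integral integral {a..t} ?A) {a..t}"
        by (rule integrable_integral[OF hcurve_area_integrable[OF zt]])
    qed ((unfold hcurve_nth(1,2))?, intro integrable_integral bdd_meas_nth_integrable[OF zt])+
    from has_integral_divide[OF this, of 2]
    have "((\<lambda>s. (?A s + (\<xi> $ 1 * z s $ 2 - \<xi> $ 2 * z s $ 1)) / 2) has_integral
       hcurve a z t $ 3 + (\<xi> $ 1 * hcurve a z t $ 2 - hcurve a z t $ 1 * \<xi> $ 2) / 2) {a..t}"
      by (simp add: hcurve_nth(3) add_divide_distrib mult.commute)
    then have "((\<lambda>s. (z s $ 2 * x s $ 1 - z s $ 1 * x s $ 2) / 2) has_integral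
       hcurve a z t $ 3 + (\<xi> $ 1 * hcurve a z t $ 2 - hcurve a z t $ 1 * \<xi> $ 2) / 2) {a..t}"
      by (rule has_integral_eq[rotated]) (simp add: eq algebra_simps)
    then show ?thesis by (rule integral_unique)
  qed
  show ?thesis
  proof
    assume L: "\<forall>t\<in>{a..b}. x t = \<xi> + set_lebesgue_integral lebesgue {a..t} (\<lambda>s. fH (x s) (z s))"
    have *: "x t $ i = \<xi> $ i + integral {a..t} (\<lambda>s. fH (x s) (z s) $ i)" if "t \<in> {a..b}" for t i
      using bspec[OF L that] int[OF that, of i] by (metis vector_add_component)
    have 12: "x t $ 1 = \<xi> $ 1 + hcurve a z t $ 1" "x t $ 2 = \<xi> $ 2 + hcurve a z t $ 2"
      if "t \<in> {a..b}" for t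
      using *[OF that, of 1] *[OF that, of 2] by (simp_all add: hcurve_nth(1,2))
    show "\<forall>t\<in>{a..b}. x t = hmul \<xi> (hcurve a z t)"
    proof
      fix t assume t: "t \<in> {a..b}"
      have "x t $ 3 = hmul \<xi> (hcurve a z t) $ 3"
        using *[OF t, of 3] 3[OF t] 12 t by simp
      then show "x t = hmul \<xi> (hcurve a z t)" using 12[OF t] by (simp add: heis_eq_iff)
    qed
  next
    assume R: "\<forall>t\<in>{a..b}. x t = hmul \<xi> (hcurve a z t)"
    show "\<forall>t\<in>{a..b}. x t = \<xi> + set_lebesgue_integral lebesgue {a..t} (\<lambda>s. fH (x s) (z s))"
    proof
      fix t assume t: "t \<in> {a..b}"
      have "x t $ 3 = \<xi> $ 3 + integral {a..t} (\<lambda>s. fH (x s) (z s) $ 3)"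
        using 3[OF t] R t by simp
      then show "x t = \<xi> + set_lebesgue_integral lebesgue {a..t} (\<lambda>s. fH (x s) (z s))"
        using R t int[OF t] by (simp add: heis_eq_iff hcurve_nth(1,2))
    qed
  qed
qed

lemma lipschitz_imp_abs_cont_curve:
  assumes lip: "\<And>c d. a \<le> c \<Longrightarrow> c \<le> d \<Longrightarrow> d \<le> b \<Longrightarrow> norm (x d - x c) \<le> B * (d - c)"
  shows "abs_cont_curve a b x"
  unfolding abs_cont_curve_def
proof (intro allI impI)
  fix e :: real assume e: "0 < e"
  \<comment> \<open>\<open>B\<close> may be zero or negative, and \<open>e / C\<close> has to be a
    positive threshold.\<close>
  define C where "C = max B 1"
  have C: "C \<ge> 1" "B \<le> C" by (auto simp: C_def)
  show "\<exists>\<delta>>0. \<forall>(n::nat) c d. (\<forall>i<n. a \<le> c i \<and> c i \<le> d i \<and> d i \<le> b) \<and>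
        disjoint_family_on (\<lambda>i. {c i<..<d i}) {..<n} \<and> (\<Sum>i<n. d i - c i) < \<delta>
        \<longrightarrow> (\<Sum>i<n. norm (x (d i) - x (c i))) < e"
  proof (intro exI[of _ "e / C"] conjI allI impI; (elim conjE)?)
    show "0 < e / C" using e C by simp
    fix n and c d :: "nat \<Rightarrow> real"
    assume cd: "\<forall>i<n. a \<le> c i \<and> c i \<le> d i \<and> d i \<le> b" and s: "(\<Sum>i<n. d i - c i) < e / C"
    have "(\<Sum>i<n. norm (x (d i) - x (c i))) \<le> (\<Sum>i<n. C * (d i - c i))"
    proof (rule sum_mono)
      fix i assume "i \<in> {..<n}"
      then have i: "a \<le> c i" "c i \<le> d i" "d i \<le> b" using cd by auto
      have "B * (d i - c i) \<le> C * (d i - c i)" using i C by (intro mult_right_mono) auto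
      with lip[OF i] show "norm (x (d i) - x (c i)) \<le> C * (d i - c i)" by linarith
    qed
    also have "\<dots> = C * (\<Sum>i<n. d i - c i)" by (simp add: sum_distrib_left)
    also have "\<dots> < e" using s C by (simp add: field_simps)
    finally show "(\<Sum>i<n. norm (x (d i) - x (c i))) < e" .
  qed
qed

lemma abs_cont_curve_imp_continuous_on:
  assumes "abs_cont_curve a b x"
  shows "continuous_on {a..b} x"
  unfolding continuous_on_iff
proof (intro ballI allI impI)
  fix t and e :: real assume t: "t \<in> {a..b}" and e: "0 < e"
  from assms[unfolded abs_cont_curve_def, rule_format, OF e]
  obtain \<delta> where "\<delta> > 0" and \<delta>: "\<forall>(n::nat) c d. (\<forall>i<n. a \<le> c i \<and> c i \<le> d i \<and> d i \<le> b) \<and>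
        disjoint_family_on (\<lambda>i. {c i<..<d i}) {..<n} \<and> (\<Sum>i<n. d i - c i) < \<delta>
        \<longrightarrow> (\<Sum>i<n. norm (x (d i) - x (c i))) < e"
    by blast
  have "dist (x s) (x t) < e" if "s \<in> {a..b}" "dist s t < \<delta>" for s
    \<comment> \<open>Families consisting of one interval suffice; the two instances cover both
      orders of \<open>s\<close> and \<open>t\<close>.\<close>
    using \<delta>[rule_format, of 1 "\<lambda>_. s" "\<lambda>_. t"] \<delta>[rule_format, of 1 "\<lambda>_. t" "\<lambda>_. s"] that t
    by (cases "s \<le> t") (auto simp: dist_norm disjoint_family_on_def norm_minus_commute)
  then show "\<exists>d>0. \<forall>x'\<in>{a..b}. dist x' t < d \<longrightarrow> dist (x x') (x t) < e"
    using \<open>\<delta> > 0\<close> by auto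
qed

text \<open>Evaluates the definite description. The left translate is Lipschitz, hence absolutely
  continuous, and solves the equation; any competitor agrees with it on \<open>{a..b}\<close> by
  \<open>horizontal_equation_iff\<close>, and elsewhere by extensionality.\<close>

lemma horizontal_curve_eq:
  assumes z: "bdd_meas a b R z" and t: "t \<in> {a..b}"
  shows "horizontal_curve a b z \<xi> t = hmul \<xi> (hcurve a z t)"
proof -
  define x where "x = restrict (\<lambda>t. hmul \<xi> (hcurve a z t)) {a..b}"
  have "continuous_on {a..b} (\<lambda>t. hmul \<xi> (hcurve a z t))"
    by (intro continuous_intros continuous_on_hcurve[OF z])
  then have cx: "continuous_on {a..b} x"
    by (rule continuous_on_eq) (simp add: x_def)
  have xeq: "\<forall>t\<in>{a..b}. x t = \<xi> + set_lebesgue_integral lebesgue {a..t} (\<lambda>s. fH (x s) (z s))"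
    by (subst horizontal_equation_iff[OF z cx]) (simp add: x_def)
  obtain B where B: "\<And>t. t \<in> {a..b} \<Longrightarrow> norm (fH (x t) (z t)) \<le> B"
    and I: "(\<lambda>s. fH (x s) (z s)) absolutely_integrable_on {a..b}"
    using fH_absolutely_integrable[OF z cx] by blast
  have ac: "abs_cont_curve a b x"
  proof (rule lipschitz_imp_abs_cont_curve)
    fix c d assume cd: "a \<le> c" "c \<le> d" "d \<le> b"
    let ?f = "\<lambda>s. fH (x s) (z s)"
    have sub: "?f absolutely_integrable_on {a..s}" if "s \<le> b" for s
      by (rule set_integrable_subset[OF I]) (use that in auto)
    have cdI: "?f integrable_on {c..d}"
      using integrable_on_subinterval[OF absolutely_integrable_imp_integrable[OF I]] cd by simp
    have "x d - x c = integral {a..d} ?f - integral {a..c} ?f"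
      using bspec[OF xeq, of c] bspec[OF xeq, of d] cd
        set_lebesgue_integral_eq_integral(2)[OF sub[of c]] set_lebesgue_integral_eq_integral(2)[OF sub[of d]]
      by auto
    also have "\<dots> = integral {c..d} ?f"
      using Henstock_Kurzweil_Integration.integral_combine[of a c d ?f] cd
        absolutely_integrable_imp_integrable[OF sub[of d]] by (simp add: algebra_simps)
    also have "norm \<dots> \<le> integral {c..d} (\<lambda>_. B)"
      by (rule integral_norm_bound_integral[OF cdI]) (use B cd in auto)
    finally show "norm (x d - x c) \<le> B * (d - c)" using cd by (simp add: mult.commute)
  qed
  have "horizontal_curve a b z \<xi> = x"
    unfolding horizontal_curve_def
  proof (rule the_equality)
    show "x \<in> extensional {a..b} \<and> is_horizontal_curve a b z \<xi> x"
      using ac xeq by (simp add: is_horizontal_curve_def x_def)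
  next
    fix y assume y: "y \<in> extensional {a..b} \<and> is_horizontal_curve a b z \<xi> y"
    then have "\<forall>t\<in>{a..b}. y t = hmul \<xi> (hcurve a z t)"
      using horizontal_equation_iff[OF z, of y] abs_cont_curve_imp_continuous_on
      unfolding is_horizontal_curve_def by blast
    then show "y = x"
      using y by (intro extensionalityI[of y "{a..b}" x]) (auto simp: x_def)
  qed
  then show ?thesis using t by (simp add: x_def)
qed

section \<open>The value function and dynamic programming\<close>

text \<open>Extension by zero turns measurability on an interval into measurability on the line,
  where a case distinction on \<open>t \<le> c\<close> is harmless.\<close>

lemma bdd_meas_join:
  assumes u: "bdd_meas a b R u" and v: "bdd_meas c b R v" and c: "a \<le> c" "c \<le> b"
  shows "bdd_meas a b R (\<lambda>t. if t \<le> c then u t else v t)"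
proof -
  have ac: "{a..b} \<in> sets lebesgue" "{c..b} \<in> sets lebesgue" by auto
  have "(\<lambda>t. if t \<in> {a..b} then u t else 0) \<in> borel_measurable lebesgue"
       "(\<lambda>t. if t \<in> {c..b} then v t else 0) \<in> borel_measurable lebesgue"
    using u v unfolding bdd_meas_def borel_measurable_if[OF ac(1)] borel_measurable_if[OF ac(2)] by auto
  then have "(\<lambda>t. if t \<le> c then if t \<in> {a..b} then u t else 0 else if t \<in> {c..b} then v t else 0)
      \<in> borel_measurable lebesgue"
    by (rule measurable_If) auto
  also have "(\<lambda>t. if t \<le> c then if t \<in> {a..b} then u t else 0 else if t \<in> {c..b} then v t else 0)
      = (\<lambda>t. if t \<in> {a..b} then if t \<le> c then u t else v t else 0)"
    using c by auto
  finally have "(\<lambda>t. if t \<le> c then u t else v t) \<in> borel_measurable (lebesgue_on {a..b})"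
    unfolding borel_measurable_if[OF ac(1)] .
  then show ?thesis using u v c unfolding bdd_meas_def by auto
qed

lemma AE_lebesgue_on_mono:
  assumes "AE s in lebesgue_on {a..b}. P s" "{c..d} \<subseteq> {a..b}"
  shows "AE s in lebesgue_on {c..d::real}. P s"
proof -
  have "negligible {s\<in>{a..b}. \<not> P s}" using assms(1) by (simp only: AE_lebesgue_on_iff_negligible fmeasurableD lmeasurable_interval)
  then have "negligible {s\<in>{c..d}. \<not> P s}" by (rule negligible_subset) (use assms(2) in auto)
  then show ?thesis by (simp only: AE_lebesgue_on_iff_negligible fmeasurableD lmeasurable_interval)
qed

lemma AE_lebesgue_on_combine:
  assumes "AE s in lebesgue_on {a..c}. P s" "AE s in lebesgue_on {c..b}. P s"
  shows "AE s in lebesgue_on {a..b::real}. P s"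
proof -
  have "negligible ({s\<in>{a..c}. \<not> P s} \<union> {s\<in>{c..b}. \<not> P s})"
    using assms by (auto simp only: AE_lebesgue_on_iff_negligible fmeasurableD lmeasurable_interval intro: negligible_Un)
  then have "negligible {s\<in>{a..b}. \<not> P s}" by (rule negligible_subset) auto
  then show ?thesis by (simp only: AE_lebesgue_on_iff_negligible fmeasurableD lmeasurable_interval)
qed

lemma AE_lebesgue_onI: "(\<And>s. s \<in> {a..b} \<Longrightarrow> P s) \<Longrightarrow> AE s in lebesgue_on {a..b::real}. P s"
  by (auto intro: AE_I2)

text \<open>A concatenated control still takes its first branch at the switching time, so on the
  second interval it equals the second piece except at the left end point.\<close>

lemma AE_lebesgue_on_except:
  assumes "AE s in lebesgue_on {a..b::real}. Q s" "\<And>s. s \<in> {a..b} \<Longrightarrow> s \<noteq> a \<Longrightarrow> Q s \<Longrightarrow> P s"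
  shows "AE s in lebesgue_on {a..b}. P s"
proof -
  have "negligible ({s\<in>{a..b}. \<not> Q s} \<union> {a})"
    using assms(1) by (auto simp only: AE_lebesgue_on_iff_negligible fmeasurableD lmeasurable_interval intro: negligible_Un negligible_sing)
  then have "negligible {s\<in>{a..b}. \<not> P s}" by (rule negligible_subset) (use assms(2) in auto)
  then show ?thesis by (simp only: AE_lebesgue_on_iff_negligible fmeasurableD lmeasurable_interval)
qed

lemma integral_cong_AE_on:
  assumes "AE s in lebesgue_on {a..b::real}. f s = g s"
  shows "integral {a..b} f = integral {a..b} g"
proof -
  have "negligible {s\<in>{a..b}. f s \<noteq> g s}"
    using assms by (simp only: AE_lebesgue_on_iff_negligible fmeasurableD lmeasurable_interval)
  then show ?thesis by (rule integral_spike) auto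
qed

text \<open>The sign is that of the game, whose velocity is \<open>- z\<close>. Unlike
  \<open>horizontal_curve\<close> there is no final time, so one expression describes the trajectory
  on every subinterval.\<close>

definition trj :: "real \<Rightarrow> heis \<Rightarrow> (real \<Rightarrow> real^2) \<Rightarrow> real \<Rightarrow> heis" where
  "trj a \<xi> z t = hmul \<xi> (hcurve a (\<lambda>s. - z s) t)"

lemma trj_start [simp]: "trj a \<xi> z a = \<xi>"
  by (simp add: trj_def)

lemma continuous_on_trj: "bdd_meas a b R z \<Longrightarrow> continuous_on {a..b} (trj a \<xi> z)"
  unfolding trj_def[abs_def] by (intro continuous_intros continuous_on_hcurve[OF bdd_meas_uminus])

lemma trj_split:
  assumes "bdd_meas a b R z" "a \<le> c" "c \<le> t" "t \<le> b"
  shows "trj a \<xi> z t = trj c (trj a \<xi> z c) z t"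
  unfolding trj_def hcurve_split[OF bdd_meas_uminus[OF assms(1)] assms(2-4)] by (simp add: hmul_assoc)

lemma trj_cong:
  assumes "AE s in lebesgue_on {a..t}. z s = z' s"
  shows "trj a \<xi> z t = trj a \<xi> z' t"
proof -
  have "AE s in lebesgue_on {a..t}. - z s = - z' s" using assms by (rule AE_mp) auto
  from hcurve_cong[OF this] show ?thesis by (simp add: trj_def)
qed

lemma dG_trj_le:
  assumes "bdd_meas a b R z" "t \<in> {a..b}"
  shows "dG (trj a \<xi> z t) \<xi> \<le> 2 * R * (t - a)"
  unfolding trj_def dG_hmul_right by (rule koranyi_hcurve_le[OF bdd_meas_uminus[OF assms(1)] assms(2)])

lemma continuous_on_dG: "continuous_on S f \<Longrightarrow> continuous_on S (\<lambda>x. dG (f x) y)"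
  unfolding dG_def by (intro continuous_on_compose2[OF continuous_on_koranyi] continuous_intros) auto

lemma controls_iff: "z \<in> controls T {z. norm z \<le> R} \<tau> \<longleftrightarrow> bdd_meas \<tau> T R z"
  by (auto simp: controls_def bdd_meas_def)

section \<open>Measurability, splitting and continuity of the payoff\<close>

locale heis_game =
  fixes T RY RZ C1 C1' C2 C2' :: real
    and Y Z :: "(real^2) set"
    and F :: "real \<Rightarrow> heis \<Rightarrow> real^2 \<Rightarrow> real^2 \<Rightarrow> real"
    and g :: "heis \<Rightarrow> real"
  assumes T: "T > 0" and RY: "RY > 0" and RZ: "RZ > 0"
    and Y: "Y = {y. norm y \<le> RY}" and Z: "Z = {z. norm z \<le> RZ}"
    and F_uc: "unif_cont_wrt dist_txyz ({0..T} \<times> UNIV \<times> Y \<times> Z) (\<lambda>(t, x, y, z). F t x y z)"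
    and F_bound: "\<And>t x y z. t \<in> {0..T} \<Longrightarrow> y \<in> Y \<Longrightarrow> z \<in> Z \<Longrightarrow> \<bar>F t x y z\<bar> \<le> C1"
    and F_lip: "\<And>t x x' y z. t \<in> {0..T} \<Longrightarrow> y \<in> Y \<Longrightarrow> z \<in> Z \<Longrightarrow>
           \<bar>F t x y z - F t x' y z\<bar> \<le> C1' * dG x x'"
    and g_bound: "\<And>x. \<bar>g x\<bar> \<le> C2"
    and g_lip: "\<And>x x'. \<bar>g x - g x'\<bar> \<le> C2' * dG x x'"
begin

lemma zero_in: "0 \<in> Y" "0 \<in> Z"
  using RY RZ by (auto simp: Y Z)

lemma C1_nonneg: "0 \<le> C1"
  using F_bound[of 0 0 0 0] zero_in T by auto

lemma controlsY: "y \<in> controls T Y \<tau> \<longleftrightarrow> bdd_meas \<tau> T RY y"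
  and controlsZ: "z \<in> controls T Z \<tau> \<longleftrightarrow> bdd_meas \<tau> T RZ z"
  by (simp_all add: Y Z controls_iff)

lemma bdd_meas_Y: "bdd_meas a b RY y \<Longrightarrow> t \<in> {a..b} \<Longrightarrow> y t \<in> Y"
  and bdd_meas_Z: "bdd_meas a b RZ z \<Longrightarrow> t \<in> {a..b} \<Longrightarrow> z t \<in> Z"
  by (auto simp: Y Z bdd_meas_def)

text \<open>The hypothesis is uniform continuity for \<open>dG\<close>; Borel measurability and
  attained extrema require ordinary continuity. The transfer works because \<open>dG (f q) x\<close>
  depends continuously on \<open>q\<close> and vanishes when \<open>f q = x\<close>.\<close>

lemma F_cont: "continuous_on ({0..T} \<times> UNIV \<times> Y \<times> Z) (\<lambda>(t, x, y, z). F t x y z)"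
  unfolding continuous_on_def tendsto_iff
proof (intro ballI allI impI)
  let ?S = "{0..T} \<times> (UNIV::heis set) \<times> Y \<times> Z"
  fix p and e :: real assume p: "p \<in> ?S" and e: "0 < e"
  obtain t x y z where p_eq: "p = (t, x, y, z)" by (cases p) auto
  obtain \<delta> where \<delta>: "\<delta> > 0" "\<And>p q. p \<in> ?S \<Longrightarrow> q \<in> ?S \<Longrightarrow> dist_txyz p q < \<delta> \<Longrightarrow>
      \<bar>(case p of (t, x, y, z) \<Rightarrow> F t x y z) - (case q of (t, x, y, z) \<Rightarrow> F t x y z)\<bar> < e"
    using F_uc e unfolding unif_cont_wrt_def by blast
  have "continuous_on UNIV (\<lambda>q. \<bar>fst q - t\<bar> + dG (fst (snd q)) x + dist (fst (snd (snd q))) y + dist (snd (snd (snd q))) z)"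
    by (intro continuous_on_add continuous_on_dG continuous_intros)
  then have "((\<lambda>q. \<bar>fst q - t\<bar> + dG (fst (snd q)) x + dist (fst (snd (snd q))) y + dist (snd (snd (snd q))) z)
      \<longlongrightarrow> \<bar>fst p - t\<bar> + dG (fst (snd p)) x + dist (fst (snd (snd p))) y + dist (snd (snd (snd p))) z) (at p within ?S)"
    unfolding continuous_on_def by (meson UNIV_I tendsto_within_subset subset_UNIV)
  then have "((\<lambda>q. dist_txyz q p) \<longlongrightarrow> 0) (at p within ?S)"
    by (simp add: p_eq dist_txyz_def case_prod_unfold)
  then have "\<forall>\<^sub>F q in at p within ?S. dist_txyz q p < \<delta>"
    using \<delta>(1) by (rule order_tendstoD)
  then show "\<forall>\<^sub>F q in at p within ?S. dist (case q of (t, x, y, z) \<Rightarrow> F t x y z) (case p of (t, x, y, z) \<Rightarrow> F t x y z) < e"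
    using \<delta>(2) p by (auto simp: eventually_at_filter dist_real_def elim!: eventually_mono)
qed

lemma F_measurable:
  assumes y: "bdd_meas a b RY y" and z: "bdd_meas a b RZ z" and ab: "0 \<le> a" "b \<le> T"
    and x: "continuous_on {a..b} x"
  shows "(\<lambda>t. F t (x t) (y t) (z t)) \<in> borel_measurable (lebesgue_on {a..b})"
proof -
  let ?S = "{0..T} \<times> (UNIV::heis set) \<times> Y \<times> Z"
  \<comment> \<open>Extended by zero off a closed set, \<open>F\<close> becomes a Borel function on
    the whole space and can be composed with the measurable map
    \<open>t \<mapsto> (t, x t, y t, z t)\<close>.\<close>
  let ?G = "\<lambda>p. indicator ?S p *\<^sub>R (case p of (t, x, y, z) \<Rightarrow> F t x y z)"
  have "Y = cball 0 RY" "Z = cball 0 RZ" by (auto simp: Y Z)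
  then have "closed ?S" by (intro closed_Times) auto
  then have G: "?G \<in> borel_measurable borel"
    by (intro borel_measurable_continuous_on_indicator F_cont) auto
  have "(\<lambda>t. (t, x t, y t, z t)) \<in> borel_measurable (lebesgue_on {a..b})"
    using y z continuous_imp_measurable_on_sets_lebesgue[OF x]
      continuous_imp_measurable_on_sets_lebesgue[of "{a..b}" "\<lambda>t. t"]
    by (intro borel_measurable_Pair) (auto simp: bdd_meas_def)
  from measurable_compose[OF this G]
  show ?thesis
    by (rule measurable_cong[THEN iffD1, rotated])
       (use bdd_meas_Y[OF y] bdd_meas_Z[OF z] ab in \<open>auto simp: indicator_def\<close>)
qed

definition run where
  "run a b \<xi> y z = integral {a..b} (\<lambda>t. F t (trj a \<xi> z t) (y t) (z t))"

lemma F_trj_integrable: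
  assumes y: "bdd_meas a b RY y" and z: "bdd_meas a b RZ z" and ab: "0 \<le> a" "b \<le> T"
  shows "(\<lambda>t. F t (trj a \<xi> z t) (y t) (z t)) absolutely_integrable_on {a..b}"
  by (rule bounded_measurable_absolutely_integrable[OF F_measurable[OF assms continuous_on_trj[OF z]], where B=C1])
     (use F_bound bdd_meas_Y[OF y] bdd_meas_Z[OF z] ab in auto)

lemmas F_trj_integrable_on = absolutely_integrable_imp_integrable[OF F_trj_integrable]

lemma run_bound:
  assumes "bdd_meas a b RY y" "bdd_meas a b RZ z" "0 \<le> a" "a \<le> b" "b \<le> T"
  shows "\<bar>run a b \<xi> y z\<bar> \<le> C1 * (b - a)"
  unfolding run_def
  by (rule integral_abs_le[OF F_trj_integrable_on])
     (use assms F_bound bdd_meas_Y[OF assms(1)] bdd_meas_Z[OF assms(2)] in auto)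

abbreviation "pay \<equiv> payoff T F g"
abbreviation "V \<equiv> lower_value T Y Z F g"

lemma payoff_eq:
  assumes "bdd_meas \<tau> T RY y" "bdd_meas \<tau> T RZ z" "0 \<le> \<tau>" "\<tau> \<le> T"
  shows "pay \<tau> \<xi> y z = run \<tau> T \<xi> y z + g (trj \<tau> \<xi> z T)"
proof -
  have h: "horizontal_curve \<tau> T (\<lambda>t. - z t) \<xi> t = trj \<tau> \<xi> z t" if "t \<in> {\<tau>..T}" for t
    unfolding trj_def by (rule horizontal_curve_eq[OF bdd_meas_uminus[OF assms(2)] that])
  have "set_lebesgue_integral lebesgue {\<tau>..T} (\<lambda>t. F t (horizontal_curve \<tau> T (\<lambda>t. - z t) \<xi> t) (y t) (z t))
      = set_lebesgue_integral lebesgue {\<tau>..T} (\<lambda>t. F t (trj \<tau> \<xi> z t) (y t) (z t))"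
    by (rule set_lebesgue_integral_cong) (auto simp: h)
  also have "\<dots> = run \<tau> T \<xi> y z"
    unfolding run_def by (rule set_lebesgue_integral_eq_integral(2)[OF F_trj_integrable]) (use assms in auto)
  finally show ?thesis
    using assms h[of T] by (simp add: payoff_def Let_def)
qed

lemma payoff_split:
  assumes y: "bdd_meas \<tau> T RY y" and z: "bdd_meas \<tau> T RZ z" and \<tau>: "0 \<le> \<tau>" "\<tau> \<le> \<sigma>" "\<sigma> \<le> T"
  shows "pay \<tau> \<xi> y z = run \<tau> \<sigma> \<xi> y z + pay \<sigma> (trj \<tau> \<xi> z \<sigma>) y z"
proof -
  have y': "bdd_meas \<sigma> T RY y" and z': "bdd_meas \<sigma> T RZ z"
    using \<tau> by (auto intro: bdd_meas_subset[OF y] bdd_meas_subset[OF z])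
  have eq: "trj \<tau> \<xi> z t = trj \<sigma> (trj \<tau> \<xi> z \<sigma>) z t" if "t \<in> {\<sigma>..T}" for t
    by (rule trj_split[OF z]) (use that \<tau> in auto)
  have "run \<tau> T \<xi> y z = run \<tau> \<sigma> \<xi> y z + integral {\<sigma>..T} (\<lambda>t. F t (trj \<tau> \<xi> z t) (y t) (z t))"
    unfolding run_def
    by (rule Henstock_Kurzweil_Integration.integral_combine[symmetric])
       (use \<tau> in \<open>auto intro!: F_trj_integrable_on y z\<close>)
  also have "integral {\<sigma>..T} (\<lambda>t. F t (trj \<tau> \<xi> z t) (y t) (z t)) = run \<sigma> T (trj \<tau> \<xi> z \<sigma>) y z"
    unfolding run_def by (rule integral_cong) (simp only: eq)
  finally show ?thesis
    using payoff_eq[OF y z] payoff_eq[OF y' z'] eq[of T] \<tau> by simp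
qed

lemma run_cong:
  assumes "AE s in lebesgue_on {a..b}. y s = y' s" and z: "AE s in lebesgue_on {a..b}. z s = z' s"
  shows "run a b \<xi> y z = run a b \<xi> y' z'"
proof -
  have t: "trj a \<xi> z s = trj a \<xi> z' s" if "s \<in> {a..b}" for s
    by (rule trj_cong[OF AE_lebesgue_on_mono[OF z]]) (use that in auto)
  have "AE s in lebesgue_on {a..b}. s \<in> {a..b}" by (rule AE_lebesgue_onI)
  with assms have "AE s in lebesgue_on {a..b}. F s (trj a \<xi> z s) (y s) (z s) = F s (trj a \<xi> z' s) (y' s) (z' s)"
    by eventually_elim (simp add: t)
  then show ?thesis unfolding run_def by (rule integral_cong_AE_on)
qed

lemma payoff_cong:
  assumes "bdd_meas \<tau> T RY y" "bdd_meas \<tau> T RZ z" "bdd_meas \<tau> T RY y'" "bdd_meas \<tau> T RZ z'"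
    and "0 \<le> \<tau>" "\<tau> \<le> T"
    and "AE s in lebesgue_on {\<tau>..T}. y s = y' s" "AE s in lebesgue_on {\<tau>..T}. z s = z' s"
  shows "pay \<tau> \<xi> y z = pay \<tau> \<xi> y' z'"
  using assms by (simp add: payoff_eq run_cong[OF assms(7,8)] trj_cong[OF assms(8)])

text \<open>A common bound for all payoffs: real \<open>INF\<close> and \<open>SUP\<close> behave as
  expected only over bounded sets.\<close>

definition bnd where "bnd = C1 * T + C2"

lemma payoff_bound:
  assumes "bdd_meas \<tau> T RY y" "bdd_meas \<tau> T RZ z" "0 \<le> \<tau>" "\<tau> \<le> T"
  shows "\<bar>pay \<tau> \<xi> y z\<bar> \<le> bnd"
proof -
  have "C1 * (T - \<tau>) \<le> C1 * T" using C1_nonneg assms by (intro mult_left_mono) auto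
  with run_bound[OF assms(1-4), of \<xi>] g_bound[of "trj \<tau> \<xi> z T"] show ?thesis
    unfolding payoff_eq[OF assms] bnd_def by auto
qed

text \<open>\<open>RZ * T\<close> bounds the first two coordinates of every curve \<open>w\<close>
  driven by a control; the first factor collects the running and the terminal cost. The absolute
  values are there because no sign of \<open>C1'\<close> and \<open>C2'\<close> is assumed.\<close>

definition smod where "smod d = (\<bar>C1'\<bar> * T + \<bar>C2'\<bar>) * conj_mod (RZ * T) d"

lemma payoff_diff:
  assumes y: "bdd_meas \<tau> T RY y" and z: "bdd_meas \<tau> T RZ z" and \<tau>: "0 \<le> \<tau>" "\<tau> \<le> T"
  shows "\<bar>pay \<tau> \<xi> y z - pay \<tau> \<xi>' y z\<bar> \<le> smod (dG \<xi> \<xi>')"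
proof -
  define m where "m = conj_mod (RZ * T) (dG \<xi> \<xi>')"
  have m0: "0 \<le> m" by (simp add: m_def conj_mod_nonneg)
  have d: "dG (trj \<tau> \<xi> z t) (trj \<tau> \<xi>' z t) \<le> m" if t: "t \<in> {\<tau>..T}" for t
    unfolding trj_def m_def
  proof (rule dG_hmul_hmul_le)
    have "RZ * (t - \<tau>) \<le> RZ * T" using RZ t \<tau> by (intro mult_left_mono) auto
    with hcurve_bounds(1,2)[OF bdd_meas_uminus[OF z] t]
    show "\<bar>hcurve \<tau> (\<lambda>s. - z s) t $ 1\<bar> \<le> RZ * T" "\<bar>hcurve \<tau> (\<lambda>s. - z s) t $ 2\<bar> \<le> RZ * T"
      by linarith+
  qed
  have Fd: "\<bar>F t (trj \<tau> \<xi> z t) (y t) (z t) - F t (trj \<tau> \<xi>' z t) (y t) (z t)\<bar> \<le> \<bar>C1'\<bar> * m"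
    if t: "t \<in> {\<tau>..T}" for t
  proof -
    have "\<bar>F t (trj \<tau> \<xi> z t) (y t) (z t) - F t (trj \<tau> \<xi>' z t) (y t) (z t)\<bar> \<le> C1' * dG (trj \<tau> \<xi> z t) (trj \<tau> \<xi>' z t)"
      using t \<tau> bdd_meas_Y[OF y t] bdd_meas_Z[OF z t] by (intro F_lip) auto
    also have "\<dots> \<le> \<bar>C1'\<bar> * m" using d[OF t] by (intro mult_mono) auto
    finally show ?thesis .
  qed
  have "run \<tau> T \<xi> y z - run \<tau> T \<xi>' y z
      = integral {\<tau>..T} (\<lambda>t. F t (trj \<tau> \<xi> z t) (y t) (z t) - F t (trj \<tau> \<xi>' z t) (y t) (z t))"
    unfolding run_def using y z \<tau> by (intro integral_diff[symmetric] F_trj_integrable_on) auto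
  also have "\<bar>\<dots>\<bar> \<le> \<bar>C1'\<bar> * m * (T - \<tau>)"
    using y z \<tau> Fd by (intro integral_abs_le integrable_diff F_trj_integrable_on) auto
  also have "\<dots> \<le> \<bar>C1'\<bar> * m * T" using m0 \<tau> by (intro mult_left_mono) auto
  finally have 1: "\<bar>run \<tau> T \<xi> y z - run \<tau> T \<xi>' y z\<bar> \<le> \<bar>C1'\<bar> * m * T" .
  have "\<bar>g (trj \<tau> \<xi> z T) - g (trj \<tau> \<xi>' z T)\<bar> \<le> C2' * dG (trj \<tau> \<xi> z T) (trj \<tau> \<xi>' z T)"
    by (rule g_lip)
  also have "\<dots> \<le> \<bar>C2'\<bar> * m" using d[of T] \<tau> by (intro mult_mono) auto
  finally show ?thesis
    using 1 unfolding payoff_eq[OF assms] smod_def m_def[symmetric] by (simp add: algebra_simps)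
qed

section \<open>Strategies and elementary properties of the value\<close>

lemma const_control: "c \<in> Y \<Longrightarrow> bdd_meas a b RY (\<lambda>_. c)"
  by (simp add: bdd_meas_def Y)

lemma strategy_bdd_meas:
  "\<beta> \<in> strategies T Y Z \<tau> \<Longrightarrow> bdd_meas \<tau> T RY y \<Longrightarrow> bdd_meas \<tau> T RZ (\<beta> y)"
  by (auto simp: strategies_def controlsY controlsZ)

lemma strategy_nonanticipative:
  "\<beta> \<in> strategies T Y Z \<tau> \<Longrightarrow> t \<in> {\<tau>..T} \<Longrightarrow> bdd_meas \<tau> T RY y \<Longrightarrow> bdd_meas \<tau> T RY y' \<Longrightarrow>
     AE s in lebesgue_on {\<tau>..t}. y s = y' s \<Longrightarrow> AE s in lebesgue_on {\<tau>..t}. \<beta> y s = \<beta> y' s"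
  unfolding strategies_def Ball_def controlsY controlsZ by blast

lemma strategiesI:
  assumes "\<And>y. bdd_meas \<tau> T RY y \<Longrightarrow> bdd_meas \<tau> T RZ (\<beta> y)"
    and "\<And>t y y'. t \<in> {\<tau>..T} \<Longrightarrow> bdd_meas \<tau> T RY y \<Longrightarrow> bdd_meas \<tau> T RY y' \<Longrightarrow>
     AE s in lebesgue_on {\<tau>..t}. y s = y' s \<Longrightarrow> AE s in lebesgue_on {\<tau>..t}. \<beta> y s = \<beta> y' s"
  shows "\<beta> \<in> strategies T Y Z \<tau>"
  using assms unfolding strategies_def Ball_def controlsY controlsZ by blast

text \<open>Makes the set over which the \<open>INF\<close> is taken nonempty.\<close>

lemma zero_strategy: "(\<lambda>_ _. 0) \<in> strategies T Y Z \<tau>"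
  using RZ by (intro strategiesI) (auto simp: bdd_meas_def)

lemma sup_payoff_bounds:
  assumes \<beta>: "\<beta> \<in> strategies T Y Z \<tau>" and \<tau>: "0 \<le> \<tau>" "\<tau> \<le> T"
  shows "bdd_above ((\<lambda>y. pay \<tau> \<xi> y (\<beta> y)) ` controls T Y \<tau>)"
    and "- bnd \<le> (SUP y\<in>controls T Y \<tau>. pay \<tau> \<xi> y (\<beta> y))"
proof -
  have b: "\<bar>pay \<tau> \<xi> y (\<beta> y)\<bar> \<le> bnd" if "y \<in> controls T Y \<tau>" for y
    using that \<tau> by (intro payoff_bound strategy_bdd_meas[OF \<beta>]) (auto simp: controlsY)
  show bd: "bdd_above ((\<lambda>y. pay \<tau> \<xi> y (\<beta> y)) ` controls T Y \<tau>)"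
    by (rule bdd_aboveI2[of _ _ bnd]) (use b in fastforce)
  have 0: "(\<lambda>_. 0) \<in> controls T Y \<tau>" by (simp add: controlsY const_control zero_in)
  show "- bnd \<le> (SUP y\<in>controls T Y \<tau>. pay \<tau> \<xi> y (\<beta> y))"
    by (rule cSUP_upper2[OF bd 0]) (use b[OF 0] in linarith)
qed

text \<open>Together with \<open>V_less\<close> this replaces the nested \<open>INF\<close> and
  \<open>SUP\<close> in the dynamic programming arguments: a guarantee against all \<open>y\<close>
  bounds the value, and every number above the value is guaranteed by some strategy.\<close>

lemma V_le:
  assumes \<beta>: "\<beta> \<in> strategies T Y Z \<tau>" and \<tau>: "0 \<le> \<tau>" "\<tau> \<le> T"
    and c: "\<And>y. bdd_meas \<tau> T RY y \<Longrightarrow> pay \<tau> \<xi> y (\<beta> y) \<le> c"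
  shows "V \<tau> \<xi> \<le> c"
proof -
  have "bdd_below ((\<lambda>\<beta>. SUP y\<in>controls T Y \<tau>. pay \<tau> \<xi> y (\<beta> y)) ` strategies T Y Z \<tau>)"
    by (rule bdd_belowI2[of _ "- bnd"]) (rule sup_payoff_bounds(2)[OF _ \<tau>])
  then show ?thesis
    unfolding lower_value_def
  proof (rule cINF_lower2[OF _ \<beta>])
    have "(\<lambda>_. 0) \<in> controls T Y \<tau>" by (simp add: controlsY const_control zero_in)
    then show "(SUP y\<in>controls T Y \<tau>. pay \<tau> \<xi> y (\<beta> y)) \<le> c"
      by (intro cSUP_least) (auto simp: controlsY c)
  qed
qed

lemma V_less:
  assumes c: "V \<tau> \<xi> < c" and \<tau>: "0 \<le> \<tau>" "\<tau> \<le> T"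
  obtains \<beta> where "\<beta> \<in> strategies T Y Z \<tau>" "\<And>y. bdd_meas \<tau> T RY y \<Longrightarrow> pay \<tau> \<xi> y (\<beta> y) \<le> c"
proof -
  have "bdd_below ((\<lambda>\<beta>. SUP y\<in>controls T Y \<tau>. pay \<tau> \<xi> y (\<beta> y)) ` strategies T Y Z \<tau>)"
    by (rule bdd_belowI2[of _ "- bnd"]) (rule sup_payoff_bounds(2)[OF _ \<tau>])
  then obtain \<beta> where \<beta>: "\<beta> \<in> strategies T Y Z \<tau>"
      and lt: "(SUP y\<in>controls T Y \<tau>. pay \<tau> \<xi> y (\<beta> y)) < c"
    using c zero_strategy unfolding lower_value_def by (subst (asm) cINF_less_iff) auto
  have "pay \<tau> \<xi> y (\<beta> y) \<le> c" if "bdd_meas \<tau> T RY y" for y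
    using cSUP_upper[OF _ sup_payoff_bounds(1)[OF \<beta> \<tau>], of y \<xi>] that lt by (simp add: controlsY)
  with \<beta> that show ?thesis by blast
qed

lemma V_bound:
  assumes \<tau>: "0 \<le> \<tau>" "\<tau> \<le> T"
  shows "\<bar>V \<tau> \<xi>\<bar> \<le> bnd"
proof -
  have "V \<tau> \<xi> \<le> bnd"
    by (rule V_le[OF zero_strategy \<tau>], rule abs_le_D1, rule payoff_bound[OF _ strategy_bdd_meas[OF zero_strategy] \<tau>])
  moreover have "- bnd \<le> V \<tau> \<xi>"
    unfolding lower_value_def
    by (rule cINF_greatest) (use zero_strategy sup_payoff_bounds(2)[OF _ \<tau>] in auto)
  ultimately show ?thesis by simp
qed

text \<open>Strategies do not refer to the initial point, so a nearly optimal strategy for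
  \<open>\<xi>'\<close> can be played from \<open>\<xi>\<close>; \<open>payoff_diff\<close> is
  uniform in the controls.\<close>

lemma V_space:
  assumes \<tau>: "0 \<le> \<tau>" "\<tau> \<le> T"
  shows "\<bar>V \<tau> \<xi> - V \<tau> \<xi>'\<bar> \<le> smod (dG \<xi> \<xi>')"
proof -
  have *: "V \<tau> \<xi> \<le> V \<tau> \<xi>' + smod (dG \<xi> \<xi>')" for \<xi> \<xi>'
  proof (rule field_le_epsilon)
    fix e :: real assume "0 < e"
    then have "V \<tau> \<xi>' < V \<tau> \<xi>' + e" by simp
    from V_less[OF this \<tau>] obtain \<beta> where \<beta>: "\<beta> \<in> strategies T Y Z \<tau>"
      and b: "\<And>y. bdd_meas \<tau> T RY y \<Longrightarrow> pay \<tau> \<xi>' y (\<beta> y) \<le> V \<tau> \<xi>' + e" by blast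
    show "V \<tau> \<xi> \<le> V \<tau> \<xi>' + smod (dG \<xi> \<xi>') + e"
    proof (rule V_le[OF \<beta> \<tau>])
      fix y assume y: "bdd_meas \<tau> T RY y"
      show "pay \<tau> \<xi> y (\<beta> y) \<le> V \<tau> \<xi>' + smod (dG \<xi> \<xi>') + e"
        using b[OF y] payoff_diff[OF y strategy_bdd_meas[OF \<beta> y] \<tau>, of \<xi> \<xi>'] by linarith
    qed
  qed
  show ?thesis using *[of \<xi> \<xi>'] *[of \<xi>' \<xi>] dG_commute[of \<xi> \<xi>'] by (simp add: abs_le_iff)
qed

text \<open>On the degenerate interval \<open>{T..T}\<close> the running cost vanishes and the
  trajectory stays at \<open>x\<close>.\<close>

lemma V_terminal: "V T x = g x"
proof -
  have p: "pay T x y z = g x" if "bdd_meas T T RY y" "bdd_meas T T RZ z" for y z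
    using payoff_eq[OF that] T by (simp add: run_def)
  have "V T x \<le> g x"
    by (rule V_le[OF zero_strategy]) (use T p strategy_bdd_meas[OF zero_strategy] in auto)
  moreover have "g x \<le> V T x"
  proof (rule field_le_epsilon)
    fix e :: real assume "0 < e"
    then have "V T x < V T x + e" by simp
    from V_less[OF this] T obtain \<beta> where \<beta>: "\<beta> \<in> strategies T Y Z T"
      and b: "\<And>y. bdd_meas T T RY y \<Longrightarrow> pay T x y (\<beta> y) \<le> V T x + e" by auto
    have y: "bdd_meas T T RY (\<lambda>_. 0)" by (rule const_control[OF zero_in(1)])
    show "g x \<le> V T x + e" using b[OF y] p[OF y strategy_bdd_meas[OF \<beta> y]] by simp
  qed
  ultimately show ?thesis by simp
qed

section \<open>The dynamic programming principle\<close>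

text \<open>Follow \<open>\<beta>\<close> up to \<open>\<sigma>\<close>, then an
  \<open>e\<close>-optimal strategy for the point reached. The resulting \<open>\<gamma>\<close> is
  nonanticipative because controls that agree beyond \<open>\<sigma>\<close> agree before it, hence
  lead to exactly the same point and the same continuation.\<close>

lemma DPP_le:
  assumes \<beta>: "\<beta> \<in> strategies T Y Z \<tau>" and \<tau>: "0 \<le> \<tau>" "\<tau> \<le> \<sigma>" "\<sigma> \<le> T"
    and c: "\<And>y. bdd_meas \<tau> T RY y \<Longrightarrow> run \<tau> \<sigma> \<xi> y (\<beta> y) + V \<sigma> (trj \<tau> \<xi> (\<beta> y) \<sigma>) \<le> c"
  shows "V \<tau> \<xi> \<le> c"
proof (rule field_le_epsilon)
  fix e :: real assume e: "0 < e"
  have \<sigma>: "0 \<le> \<sigma>" and \<tau>T: "\<tau> \<le> T" using \<tau> by auto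
  have "\<exists>\<beta>\<in>strategies T Y Z \<sigma>. \<forall>y. bdd_meas \<sigma> T RY y \<longrightarrow> pay \<sigma> \<eta> y (\<beta> y) \<le> V \<sigma> \<eta> + e" for \<eta>
    using V_less[of \<sigma> \<eta> "V \<sigma> \<eta> + e"] e \<sigma> \<tau>(3) by (metis less_add_same_cancel1)
  \<comment> \<open>No measurable choice in \<open>\<eta>\<close> is needed: a strategy is only required to be nonanticipative.\<close>
  then obtain B where B: "\<And>\<eta>. B \<eta> \<in> strategies T Y Z \<sigma>"
    and Bp: "\<And>\<eta> y. bdd_meas \<sigma> T RY y \<Longrightarrow> pay \<sigma> \<eta> y (B \<eta> y) \<le> V \<sigma> \<eta> + e" by metis
  define \<gamma> where "\<gamma> y t = (if t \<le> \<sigma> then \<beta> y t else B (trj \<tau> \<xi> (\<beta> y) \<sigma>) y t)" for y t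
  have sub: "bdd_meas \<sigma> T R y" if "bdd_meas \<tau> T R y" for R y
    by (rule bdd_meas_subset[OF that]) (use \<tau> in auto)
  have \<gamma>m: "bdd_meas \<tau> T RZ (\<gamma> y)" if "bdd_meas \<tau> T RY y" for y
    unfolding \<gamma>_def[abs_def] using \<tau> that
    by (intro bdd_meas_join strategy_bdd_meas[OF \<beta>] strategy_bdd_meas[OF B] sub)
  have \<gamma>1: "AE s in lebesgue_on {\<tau>..\<sigma>}. \<gamma> y s = \<beta> y s" for y
    by (rule AE_lebesgue_onI) (simp add: \<gamma>_def)
  have \<gamma>2: "AE s in lebesgue_on {\<sigma>..t}. \<gamma> y s = B (trj \<tau> \<xi> (\<beta> y) \<sigma>) y s" for y t
    by (rule AE_lebesgue_on_except[where Q="\<lambda>_. True"]) (auto simp: \<gamma>_def)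
  have "\<gamma> \<in> strategies T Y Z \<tau>"
  proof (rule strategiesI[OF \<gamma>m])
    fix t y y' assume t: "t \<in> {\<tau>..T}" and y: "bdd_meas \<tau> T RY y" "bdd_meas \<tau> T RY y'"
      and eq: "AE s in lebesgue_on {\<tau>..t}. y s = y' s"
    show "AE s in lebesgue_on {\<tau>..t}. \<gamma> y s = \<gamma> y' s"
    proof (cases "t \<le> \<sigma>")
      case True
      have "AE s in lebesgue_on {\<tau>..t}. \<beta> y s = \<beta> y' s"
        by (rule strategy_nonanticipative[OF \<beta> t y eq])
      moreover have "AE s in lebesgue_on {\<tau>..t}. \<gamma> y s = \<beta> y s" "AE s in lebesgue_on {\<tau>..t}. \<gamma> y' s = \<beta> y' s"
        using True by (auto intro!: AE_lebesgue_on_mono[OF \<gamma>1])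
      ultimately show ?thesis by eventually_elim simp
    next
      case False
      then have s: "\<sigma> \<in> {\<tau>..T}" and t': "t \<in> {\<sigma>..T}" using \<tau> t by auto
      have b: "AE s in lebesgue_on {\<tau>..\<sigma>}. \<beta> y s = \<beta> y' s"
        by (rule strategy_nonanticipative[OF \<beta> s y AE_lebesgue_on_mono[OF eq]]) (use False in auto)
      \<comment> \<open>Almost everywhere equal replies give identical positions, so
        \<open>B\<close> is evaluated at one and the same point for \<open>y\<close> and
        \<open>y'\<close>.\<close>
      then have x: "trj \<tau> \<xi> (\<beta> y) \<sigma> = trj \<tau> \<xi> (\<beta> y') \<sigma>" by (rule trj_cong)
      have "AE s in lebesgue_on {\<sigma>..t}. B (trj \<tau> \<xi> (\<beta> y) \<sigma>) y s = B (trj \<tau> \<xi> (\<beta> y') \<sigma>) y' s"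
        unfolding x by (rule strategy_nonanticipative[OF B t' sub[OF y(1)] sub[OF y(2)] AE_lebesgue_on_mono[OF eq]])
           (use \<tau> in auto)
      with \<gamma>2[of y t] \<gamma>2[of y' t] have "AE s in lebesgue_on {\<sigma>..t}. \<gamma> y s = \<gamma> y' s"
        by eventually_elim simp
      moreover from b \<gamma>1[of y] \<gamma>1[of y'] have "AE s in lebesgue_on {\<tau>..\<sigma>}. \<gamma> y s = \<gamma> y' s"
        by eventually_elim simp
      ultimately show ?thesis by (rule AE_lebesgue_on_combine[rotated])
    qed
  qed
  then show "V \<tau> \<xi> \<le> c + e"
  proof (rule V_le[OF _ \<tau>(1) \<tau>T])
    fix y assume y: "bdd_meas \<tau> T RY y"
    let ?x = "trj \<tau> \<xi> (\<beta> y) \<sigma>"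
    have "pay \<tau> \<xi> y (\<gamma> y) = run \<tau> \<sigma> \<xi> y (\<gamma> y) + pay \<sigma> (trj \<tau> \<xi> (\<gamma> y) \<sigma>) y (\<gamma> y)"
      by (rule payoff_split[OF y \<gamma>m[OF y] \<tau>])
    also have "trj \<tau> \<xi> (\<gamma> y) \<sigma> = ?x" by (rule trj_cong[OF \<gamma>1])
    also have "run \<tau> \<sigma> \<xi> y (\<gamma> y) = run \<tau> \<sigma> \<xi> y (\<beta> y)" by (rule run_cong[OF _ \<gamma>1]) auto
    also have "pay \<sigma> ?x y (\<gamma> y) = pay \<sigma> ?x y (B ?x y)"
      by (rule payoff_cong[OF sub[OF y] sub[OF \<gamma>m[OF y]] sub[OF y] strategy_bdd_meas[OF B sub[OF y]] \<sigma> \<tau>(3) _ \<gamma>2]) auto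
    finally show "pay \<tau> \<xi> y (\<gamma> y) \<le> c + e"
      using Bp[OF sub[OF y], of ?x] c[OF y] by linarith
  qed
qed

text \<open>A strategy good on the whole horizon stays good after \<open>\<sigma>\<close>: with the
  past \<open>y\<close> frozen, \<open>\<gamma> y2 = \<beta> (J y2)\<close> is a strategy on
  \<open>{\<sigma>..T}\<close>. Nonanticipativity makes its past reply equal
  \<open>\<beta> y\<close> whatever \<open>y2\<close> is, so the cost up to \<open>\<sigma>\<close>
  can be subtracted.\<close>

lemma DPP_ge:
  assumes c: "V \<tau> \<xi> < c" and \<tau>: "0 \<le> \<tau>" "\<tau> \<le> \<sigma>" "\<sigma> \<le> T"
  obtains \<beta> where "\<beta> \<in> strategies T Y Z \<tau>"
    "\<And>y. bdd_meas \<tau> T RY y \<Longrightarrow> run \<tau> \<sigma> \<xi> y (\<beta> y) + V \<sigma> (trj \<tau> \<xi> (\<beta> y) \<sigma>) \<le> c"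
proof -
  have \<sigma>: "0 \<le> \<sigma>" and \<tau>T: "\<tau> \<le> T" using \<tau> by auto
  from V_less[OF c \<tau>(1) \<tau>T] obtain \<beta> where \<beta>: "\<beta> \<in> strategies T Y Z \<tau>"
    and b: "\<And>y. bdd_meas \<tau> T RY y \<Longrightarrow> pay \<tau> \<xi> y (\<beta> y) \<le> c" by blast
  have sub: "bdd_meas \<sigma> T R y" if "bdd_meas \<tau> T R y" for R y
    by (rule bdd_meas_subset[OF that]) (use \<tau> in auto)
  have "run \<tau> \<sigma> \<xi> y (\<beta> y) + V \<sigma> (trj \<tau> \<xi> (\<beta> y) \<sigma>) \<le> c" if y: "bdd_meas \<tau> T RY y" for y
  proof -
    define J where "J y2 t = (if t \<le> \<sigma> then y t else y2 t)" for y2 t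
    define \<gamma> where "\<gamma> y2 = \<beta> (J y2)" for y2
    have Jm: "bdd_meas \<tau> T RY (J y2)" if "bdd_meas \<sigma> T RY y2" for y2
      unfolding J_def[abs_def] by (rule bdd_meas_join[OF y that \<tau>(2,3)])
    have J1: "AE s in lebesgue_on {\<tau>..\<sigma>}. J y2 s = y s" for y2
      by (rule AE_lebesgue_onI) (simp add: J_def)
    have J2: "AE s in lebesgue_on {\<sigma>..t}. J y2 s = y2 s" for y2 t
      by (rule AE_lebesgue_on_except[where Q="\<lambda>_. True"]) (auto simp: J_def)
    have \<gamma>m: "bdd_meas \<tau> T RZ (\<gamma> y2)" if "bdd_meas \<sigma> T RY y2" for y2
      unfolding \<gamma>_def by (rule strategy_bdd_meas[OF \<beta> Jm[OF that]])
    have "\<gamma> \<in> strategies T Y Z \<sigma>"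
    proof (rule strategiesI[OF sub[OF \<gamma>m]])
      fix t u v assume t: "t \<in> {\<sigma>..T}" and u: "bdd_meas \<sigma> T RY u" and v: "bdd_meas \<sigma> T RY v"
        and eq: "AE s in lebesgue_on {\<sigma>..t}. u s = v s"
      have t': "t \<in> {\<tau>..T}" using t \<tau> by auto
      from eq J2[of u t] J2[of v t] have "AE s in lebesgue_on {\<sigma>..t}. J u s = J v s"
        by eventually_elim simp
      moreover from J1[of u] J1[of v] have "AE s in lebesgue_on {\<tau>..\<sigma>}. J u s = J v s"
        by eventually_elim simp
      ultimately have "AE s in lebesgue_on {\<tau>..t}. J u s = J v s"
        by (rule AE_lebesgue_on_combine[rotated])
      from strategy_nonanticipative[OF \<beta> t' Jm[OF u] Jm[OF v] this]
      show "AE s in lebesgue_on {\<sigma>..t}. \<gamma> u s = \<gamma> v s"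
        unfolding \<gamma>_def by (rule AE_lebesgue_on_mono) (use \<tau> in auto)
    qed
    then have "V \<sigma> (trj \<tau> \<xi> (\<beta> y) \<sigma>) \<le> c - run \<tau> \<sigma> \<xi> y (\<beta> y)"
    proof (rule V_le[OF _ \<sigma> \<tau>(3)])
      fix u assume u: "bdd_meas \<sigma> T RY u"
      have s: "\<sigma> \<in> {\<tau>..T}" using \<tau> by auto
      have z1: "AE s in lebesgue_on {\<tau>..\<sigma>}. \<gamma> u s = \<beta> y s"
        unfolding \<gamma>_def by (rule strategy_nonanticipative[OF \<beta> s Jm[OF u] y J1])
      have "pay \<tau> \<xi> (J u) (\<gamma> u) = run \<tau> \<sigma> \<xi> (J u) (\<gamma> u) + pay \<sigma> (trj \<tau> \<xi> (\<gamma> u) \<sigma>) (J u) (\<gamma> u)"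
        by (rule payoff_split[OF Jm[OF u] \<gamma>m[OF u] \<tau>])
      also have "trj \<tau> \<xi> (\<gamma> u) \<sigma> = trj \<tau> \<xi> (\<beta> y) \<sigma>" by (rule trj_cong[OF z1])
      also have "run \<tau> \<sigma> \<xi> (J u) (\<gamma> u) = run \<tau> \<sigma> \<xi> y (\<beta> y)" by (rule run_cong[OF J1 z1])
      also have "pay \<sigma> (trj \<tau> \<xi> (\<beta> y) \<sigma>) (J u) (\<gamma> u) = pay \<sigma> (trj \<tau> \<xi> (\<beta> y) \<sigma>) u (\<gamma> u)"
        by (rule payoff_cong[OF sub[OF Jm[OF u]] sub[OF \<gamma>m[OF u]] u sub[OF \<gamma>m[OF u]] \<sigma> \<tau>(3) J2]) auto
      finally show "pay \<sigma> (trj \<tau> \<xi> (\<beta> y) \<sigma>) u (\<gamma> u) \<le> c - run \<tau> \<sigma> \<xi> y (\<beta> y)"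
        using b[OF Jm[OF u]] unfolding \<gamma>_def by linarith
    qed
    then show ?thesis by simp
  qed
  with \<beta> that show ?thesis by blast
qed

section \<open>Uniform continuity of the value in time and space\<close>

lemma smod_mono: "0 \<le> d \<Longrightarrow> d \<le> d' \<Longrightarrow> smod d \<le> smod d'"
  unfolding smod_def using RZ T by (intro mult_left_mono conj_mod_mono) auto

text \<open>Dynamic programming with crude bounds: between \<open>\<tau>\<close> and
  \<open>\<sigma>\<close> the running cost is at most \<open>C1 * (\<sigma> - \<tau>)\<close>, and
  the position moves by gauge at most \<open>2 * RZ * (\<sigma> - \<tau>)\<close>, which the modulus
  in space converts.\<close>

lemma V_time:
  assumes \<tau>: "0 \<le> \<tau>" "\<tau> \<le> \<sigma>" "\<sigma> \<le> T"
  shows "\<bar>V \<tau> \<xi> - V \<sigma> \<xi>\<bar> \<le> C1 * (\<sigma> - \<tau>) + smod (2 * RZ * (\<sigma> - \<tau>))"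
proof -
  have key: "\<bar>run \<tau> \<sigma> \<xi> y z + V \<sigma> (trj \<tau> \<xi> z \<sigma>) - V \<sigma> \<xi>\<bar> \<le> C1 * (\<sigma> - \<tau>) + smod (2 * RZ * (\<sigma> - \<tau>))"
    if y: "bdd_meas \<tau> T RY y" and z: "bdd_meas \<tau> T RZ z" for y z
  proof -
    have "bdd_meas \<tau> \<sigma> RY y" "bdd_meas \<tau> \<sigma> RZ z"
      using \<tau> by (auto intro: bdd_meas_subset[OF y] bdd_meas_subset[OF z])
    then have "\<bar>run \<tau> \<sigma> \<xi> y z\<bar> \<le> C1 * (\<sigma> - \<tau>)" by (rule run_bound) (use \<tau> in auto)
    moreover have "\<bar>V \<sigma> (trj \<tau> \<xi> z \<sigma>) - V \<sigma> \<xi>\<bar> \<le> smod (dG (trj \<tau> \<xi> z \<sigma>) \<xi>)"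
      by (rule V_space) (use \<tau> in auto)
    moreover have "smod (dG (trj \<tau> \<xi> z \<sigma>) \<xi>) \<le> smod (2 * RZ * (\<sigma> - \<tau>))"
      by (rule smod_mono[OF dG_nonneg dG_trj_le[OF z]]) (use \<tau> in auto)
    ultimately show ?thesis by linarith
  qed
  have "V \<tau> \<xi> \<le> V \<sigma> \<xi> + (C1 * (\<sigma> - \<tau>) + smod (2 * RZ * (\<sigma> - \<tau>)))"
  proof (rule DPP_le[OF zero_strategy \<tau>])
    fix y assume y: "bdd_meas \<tau> T RY y"
    show "run \<tau> \<sigma> \<xi> y (\<lambda>_. 0) + V \<sigma> (trj \<tau> \<xi> (\<lambda>_. 0) \<sigma>) \<le> V \<sigma> \<xi> + (C1 * (\<sigma> - \<tau>) + smod (2 * RZ * (\<sigma> - \<tau>)))"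
      using key[OF y strategy_bdd_meas[OF zero_strategy y]] by linarith
  qed
  moreover have "V \<sigma> \<xi> - (C1 * (\<sigma> - \<tau>) + smod (2 * RZ * (\<sigma> - \<tau>))) \<le> V \<tau> \<xi>"
  proof (rule field_le_epsilon)
    fix e :: real assume "0 < e"
    then have "V \<tau> \<xi> < V \<tau> \<xi> + e" by simp
    from DPP_ge[OF this \<tau>] obtain \<beta> where \<beta>: "\<beta> \<in> strategies T Y Z \<tau>" and
      b: "\<And>y. bdd_meas \<tau> T RY y \<Longrightarrow> run \<tau> \<sigma> \<xi> y (\<beta> y) + V \<sigma> (trj \<tau> \<xi> (\<beta> y) \<sigma>) \<le> V \<tau> \<xi> + e" by blast
    have y: "bdd_meas \<tau> T RY (\<lambda>_. 0)" by (rule const_control[OF zero_in(1)])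
    show "V \<sigma> \<xi> - (C1 * (\<sigma> - \<tau>) + smod (2 * RZ * (\<sigma> - \<tau>))) \<le> V \<tau> \<xi> + e"
      using b[OF y] key[OF y strategy_bdd_meas[OF \<beta> y]] by linarith
  qed
  ultimately show ?thesis by (simp add: abs_le_iff)
qed

lemma smod_tendsto: "(smod \<longlongrightarrow> 0) (at_right 0)"
proof -
  have "(smod \<longlongrightarrow> (\<bar>C1'\<bar> * T + \<bar>C2'\<bar>) * 0) (at_right 0)"
    unfolding smod_def[abs_def] by (intro tendsto_intros conj_mod_tendsto)
  then show ?thesis by simp
qed

lemma V_uniformly_continuous: "unif_cont_wrt dist_tx ({0..T} \<times> UNIV) (\<lambda>(t, x). V t x)"
  unfolding unif_cont_wrt_def
proof (intro allI impI)
  fix e :: real assume e: "0 < e"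
  define \<omega> where "\<omega> d = C1 * d + smod (2 * RZ * d) + smod d" for d
  have "((\<lambda>d. smod (2 * RZ * d)) \<longlongrightarrow> 0) (at_right 0)"
  proof (rule filterlim_compose[OF smod_tendsto])
    have "\<forall>\<^sub>F d in at_right 0. 2 * RZ * d \<in> {0<..} \<and> 2 * RZ * d \<noteq> 0"
      using eventually_at_right_less[of 0] by eventually_elim (use RZ in auto)
    moreover have "((\<lambda>d. 2 * RZ * d) \<longlongrightarrow> 0) (at_right 0)"
      by (auto intro!: tendsto_eq_intros)
    ultimately show "filterlim (\<lambda>d. 2 * RZ * d) (at_right 0) (at_right 0)"
      by (simp add: filterlim_at)
  qed
  then have "(\<omega> \<longlongrightarrow> C1 * 0 + 0 + 0) (at_right 0)"
    unfolding \<omega>_def[abs_def] by (intro tendsto_intros smod_tendsto)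
  then have "\<forall>\<^sub>F d in at_right 0. \<omega> d < e" using e by (intro order_tendstoD) auto
  then have "\<forall>\<^sub>F d in at_right 0. \<omega> d < e \<and> 0 < d"
    by (intro eventually_conj eventually_at_right_less)
  \<comment> \<open>The modulus \<open>\<omega>\<close> is monotone, so one value
    \<open>\<omega> \<delta> < e\<close> controls all smaller distances.\<close>
  then obtain \<delta> where \<delta>: "0 < \<delta>" "\<omega> \<delta> < e"
    using eventually_happens by force
  have mono: "\<omega> d \<le> \<omega> d'" if "0 \<le> d" "d \<le> d'" for d d'
    unfolding \<omega>_def using that C1_nonneg RZ by (intro add_mono mult_left_mono smod_mono) auto
  have *: "\<bar>V t x - V t' x'\<bar> \<le> \<omega> (\<bar>t - t'\<bar> + dG x x')" if t: "t \<in> {0..T}" "t' \<in> {0..T}" for t t' x x'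
  proof -
    let ?d = "\<bar>t - t'\<bar> + dG x x'"
    have "\<bar>V t x - V t' x\<bar> \<le> C1 * \<bar>t - t'\<bar> + smod (2 * RZ * \<bar>t - t'\<bar>)"
      using V_time[of t t' x] V_time[of t' t x] t by (cases "t \<le> t'") (auto simp: abs_minus_commute)
    also have "\<dots> \<le> C1 * ?d + smod (2 * RZ * ?d)"
      using C1_nonneg RZ by (intro add_mono mult_left_mono smod_mono) auto
    finally have "\<bar>V t x - V t' x\<bar> \<le> C1 * ?d + smod (2 * RZ * ?d)" .
    moreover have "\<bar>V t' x - V t' x'\<bar> \<le> smod (dG x x')" using t by (intro V_space) auto
    moreover have "smod (dG x x') \<le> smod ?d" by (intro smod_mono) auto
    ultimately show ?thesis unfolding \<omega>_def by linarith
  qed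
  show "\<exists>\<delta>>0. \<forall>p\<in>{0..T} \<times> UNIV. \<forall>q\<in>{0..T} \<times> UNIV. dist_tx p q < \<delta> \<longrightarrow>
      \<bar>(case p of (t, x) \<Rightarrow> V t x) - (case q of (t, x) \<Rightarrow> V t x)\<bar> < e"
  proof (intro exI[of _ \<delta>] conjI ballI impI)
    fix p q assume p: "p \<in> {0..T} \<times> (UNIV::heis set)" "q \<in> {0..T} \<times> (UNIV::heis set)" and d: "dist_tx p q < \<delta>"
    obtain t x t' x' where pq: "p = (t, x)" "q = (t', x')" by (cases p, cases q) auto
    have "\<bar>V t x - V t' x'\<bar> \<le> \<omega> (\<bar>t - t'\<bar> + dG x x')" using p by (intro *) (auto simp: pq)
    also have "\<dots> \<le> \<omega> \<delta>" using d by (intro mono) (auto simp: pq dist_tx_def)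
    finally show "\<bar>(case p of (t, x) \<Rightarrow> V t x) - (case q of (t, x) \<Rightarrow> V t x)\<bar> < e"
      using \<delta> by (simp add: pq)
  qed (rule \<delta>)
qed

end

section \<open>First order expansion of test functions\<close>

definition e1 :: "real \<Rightarrow> heis" where "e1 s = vector [s, 0, 0]"
definition e2 :: "real \<Rightarrow> heis" where "e2 s = vector [0, s, 0]"

lemma e1_nth [simp]: "e1 s $ 1 = s" "e1 s $ 2 = 0" "e1 s $ 3 = 0"
  and e2_nth [simp]: "e2 s $ 1 = 0" "e2 s $ 2 = s" "e2 s $ 3 = 0"
  by (simp_all add: e1_def e2_def)

lemma X1_nth [simp]: "X1 x $ 1 = 1" "X1 x $ 2 = 0" "X1 x $ 3 = - x$2 / 2"
  and X2_nth [simp]: "X2 x $ 1 = 0" "X2 x $ 2 = 1" "X2 x $ 3 = x$1 / 2"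
  by (simp_all add: X1_def X2_def)

text \<open>\<open>e1\<close> and \<open>e2\<close> are one-parameter subgroups, and the flows of
  the left invariant fields are right translations by them. Each field is constant along its own
  flow lines.\<close>

lemma X1_flow: "x + s *\<^sub>R X1 x = hmul x (e1 s)" "X1 (x + s *\<^sub>R X1 x) = X1 x"
  and X2_flow: "x + s *\<^sub>R X2 x = hmul x (e2 s)" "X2 (x + s *\<^sub>R X2 x) = X2 x"
  by (simp_all add: heis_eq_iff)

lemma grad_H_nth: "grad_H u x $ 1 = deriv (along X1 u x) 0" "grad_H u x $ 2 = deriv (along X2 u x) 0"
  by (simp_all add: grad_H_def)

lemma real_diff_bound:
  fixes f f' :: "real \<Rightarrow> real"
  assumes f: "\<And>s. s \<in> closed_segment a b \<Longrightarrow> (f has_field_derivative f' s) (at s)"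
    and p: "\<And>s. s \<in> closed_segment a b \<Longrightarrow> \<bar>f' s - p\<bar> \<le> \<epsilon>"
  shows "\<bar>f b - f a - p * (b - a)\<bar> \<le> \<epsilon> * \<bar>b - a\<bar>"
proof -
  have "norm ((f b - p * b) - (f a - p * a)) \<le> \<epsilon> * norm (b - a)"
  proof (rule field_differentiable_bound[where S="closed_segment a b" and f="\<lambda>s. f s - p * s" and f'="\<lambda>s. f' s - p"])
    fix s assume s: "s \<in> closed_segment a b"
    show "((\<lambda>s. f s - p * s) has_field_derivative f' s - p) (at s within closed_segment a b)"
      by (rule DERIV_subset[of _ _ _ UNIV]) (auto intro!: derivative_eq_intros f[OF s])
    show "norm (f' s - p) \<le> \<epsilon>" using p[OF s] by simp
  qed auto
  then show ?thesis by (simp add: algebra_simps)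
qed

text \<open>Differentiability is given at parameter 0 only, but for every base point. Since
  \<open>X\<close> is constant along the line, the derivative at \<open>r\<close> is the derivative
  at 0 from the base point \<open>x + r *\<^sub>R X x\<close>, and the mean value theorem
  applies.\<close>

lemma along_diff_bound:
  assumes inv: "\<And>x s. X (x + s *\<^sub>R X x) = X x"
    and diff: "\<And>x. along X u x field_differentiable (at 0)"
    and p: "\<And>r. \<bar>r\<bar> \<le> \<bar>s\<bar> \<Longrightarrow> \<bar>deriv (along X u (x + r *\<^sub>R X x)) 0 - p\<bar> \<le> \<epsilon>"
  shows "\<bar>u (x + s *\<^sub>R X x) - u x - p * s\<bar> \<le> \<epsilon> * \<bar>s\<bar>"
proof -
  have "(along X u x has_field_derivative deriv (along X u (x + r *\<^sub>R X x)) 0) (at r)" for r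
  proof -
    have eq: "along X u x = (\<lambda>q. along X u (x + r *\<^sub>R X x) (q - r))"
      by (simp add: along_def inv fun_eq_iff algebra_simps)
    have "(along X u (x + r *\<^sub>R X x) has_field_derivative deriv (along X u (x + r *\<^sub>R X x)) 0) (at (r - r))"
      using field_differentiable_derivI[OF diff[of "x + r *\<^sub>R X x"]] by simp
    moreover have "((\<lambda>q. q - r) has_field_derivative 1) (at r)"
      by (auto intro!: derivative_eq_intros)
    ultimately have "((\<lambda>q. along X u (x + r *\<^sub>R X x) (q - r)) has_field_derivative
        deriv (along X u (x + r *\<^sub>R X x)) 0 * 1) (at r)"
      by (rule DERIV_chain2[where f="along X u (x + r *\<^sub>R X x)" and g="\<lambda>q. q - r"])
    then show ?thesis by (subst eq) simp
  qed
  then have "\<bar>along X u x s - along X u x 0 - p * (s - 0)\<bar> \<le> \<epsilon> * \<bar>s - 0\<bar>"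
    by (rule real_diff_bound) (use p in \<open>auto simp: closed_segment_eq_real_ivl split: if_splits\<close>)
  then show ?thesis by (simp add: along_def)
qed

text \<open>Bounds for a product of \<open>k\<close> segments of length at most \<open>2 * r\<close>.\<close>

definition near :: "real \<Rightarrow> real \<Rightarrow> heis \<Rightarrow> bool" where
  "near k r v \<longleftrightarrow> \<bar>v$1\<bar> \<le> 2 * k * r \<and> \<bar>v$2\<bar> \<le> 2 * k * r \<and> \<bar>v$3\<bar> \<le> 4 * k\<^sup>2 * r\<^sup>2"

text \<open>The third coordinate changes by at most \<open>2 * k * r\<^sup>2\<close>, well within
  the increase of \<open>4 * k\<^sup>2 * r\<^sup>2\<close> when \<open>k\<close> becomes
  \<open>k + 1\<close>.\<close>

lemma near_step:
  assumes v: "near k r v" and s: "\<bar>s\<bar> \<le> 2 * r" and k: "0 \<le> k"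
  shows "near (k + 1) r (hmul v (e1 s))" "near (k + 1) r (hmul v (e2 s))"
proof -
  have r: "0 \<le> r" using s by linarith
  have "\<bar>s * v$2\<bar> \<le> (2 * r) * (2 * k * r)" "\<bar>v$1 * s\<bar> \<le> (2 * k * r) * (2 * r)"
    unfolding abs_mult by (intro mult_mono; use v s r k in \<open>simp add: near_def\<close>)+
  then have b: "\<bar>s * v$2\<bar> \<le> 4 * (k * r\<^sup>2)" "\<bar>v$1 * s\<bar> \<le> 4 * (k * r\<^sup>2)"
    by (simp_all add: power2_eq_square algebra_simps)
  have A: "4 * (k + 1)\<^sup>2 * r\<^sup>2 = 4 * k\<^sup>2 * r\<^sup>2 + 8 * (k * r\<^sup>2) + 4 * r\<^sup>2" "2 * (k + 1) * r = 2 * k * r + 2 * r"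
    by (simp_all add: power2_eq_square algebra_simps)
  have v': "\<bar>v$1\<bar> \<le> 2 * k * r" "\<bar>v$2\<bar> \<le> 2 * k * r" "\<bar>v$3\<bar> \<le> 4 * k\<^sup>2 * r\<^sup>2"
    using v by (auto simp: near_def)
  have nonneg: "0 \<le> k * r\<^sup>2" "0 \<le> r\<^sup>2" "0 \<le> 2 * k * r" using k r by auto
  have "\<bar>v$3 + c / 2\<bar> \<le> 4 * k\<^sup>2 * r\<^sup>2 + 8 * (k * r\<^sup>2) + 4 * r\<^sup>2" if "\<bar>c\<bar> \<le> 4 * (k * r\<^sup>2)" for c
    using v'(3) that nonneg by linarith
  from this[of "- (s * v$2)"] this[of "v$1 * s"] b
  have 3: "\<bar>v$3 - s * v$2 / 2\<bar> \<le> 4 * k\<^sup>2 * r\<^sup>2 + 8 * (k * r\<^sup>2) + 4 * r\<^sup>2"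
       "\<bar>v$3 + v$1 * s / 2\<bar> \<le> 4 * k\<^sup>2 * r\<^sup>2 + 8 * (k * r\<^sup>2) + 4 * r\<^sup>2" by auto
  have 12: "\<bar>v$i + s\<bar> \<le> 2 * k * r + 2 * r" "\<bar>v$i\<bar> \<le> 2 * k * r + 2 * r" if "i = 1 \<or> i = 2" for i
    using v' s r that by auto
  show "near (k + 1) r (hmul v (e1 s))" "near (k + 1) r (hmul v (e2 s))"
    unfolding near_def A using 12 3 by simp_all
qed

text \<open>Six is the number of segments in the factorization below, and
  \<open>168 = 12 + 12 + 144\<close> adds the three coordinate bounds, using
  \<open>r\<^sup>2 \<le> r\<close>.\<close>

lemma near_norm_le:
  assumes "near k r v" "k \<le> 6" "0 \<le> k" "0 \<le> r" "r \<le> 1"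
  shows "norm v \<le> 168 * r"
proof -
  have "norm v \<le> \<bar>v$1\<bar> + \<bar>v$2\<bar> + \<bar>v$3\<bar>"
    using norm_le_l1_cart[of v] by (simp add: sum_3)
  moreover have "k * r \<le> 6 * r" using assms by (intro mult_right_mono) auto
  moreover have "k\<^sup>2 * r\<^sup>2 \<le> 6\<^sup>2 * r" 
    using assms power_decreasing[of 1 2 r] by (intro mult_mono power_mono) auto
  ultimately show ?thesis using assms(1) unfolding near_def by simp
qed

text \<open>The commutator of \<open>e1 s\<close> and \<open>e2 \<sigma>\<close> is central with third coordinate \<open>s * \<sigma>\<close>, so a central
  residue of order \<open>r\<^sup>2\<close> is reached by horizontal segments of length of order \<open>r\<close>.\<close>

lemma horizontal_factorization:
  assumes "koranyi w \<le> r"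
  obtains s \<sigma> where "\<bar>s\<bar> \<le> 2 * r" "\<bar>\<sigma>\<bar> \<le> 2 * r"
    "w = hmul (hmul (hmul (hmul (hmul (e1 (w$1)) (e2 (w$2))) (e1 s)) (e2 \<sigma>)) (e1 (- s))) (e2 (- \<sigma>))"
proof -
  \<comment> \<open>\<open>hmul (e1 (w$1)) (e2 (w$2))\<close> already has third coordinate
    \<open>w$1 * w$2 / 2\<close>; \<open>c\<close> is the central residue left for the
    commutator.\<close>
  define c where "c = w$3 - w$1 * w$2 / 2"
  define s where "s = sqrt \<bar>c\<bar>"
  have r: "0 \<le> r" using assms koranyi_nonneg[of w] by linarith
  have "\<bar>w$3\<bar> \<le> (koranyi w)\<^sup>2" "(koranyi w)\<^sup>2 \<le> r\<^sup>2"
    using koranyi_coords[of w] assms by (auto intro: power_mono)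
  moreover have "\<bar>w$1 * w$2\<bar> \<le> r * r"
    unfolding abs_mult using koranyi_coords[of w] assms r by (intro mult_mono) auto
  ultimately have "\<bar>c\<bar> \<le> (2 * r)\<^sup>2"
    unfolding c_def by (simp add: power2_eq_square)
  then have "s \<le> 2 * r" unfolding s_def using r by (simp add: real_le_lsqrt)
  moreover have "0 \<le> s" by (simp add: s_def)
  moreover have "s * (sgn c * s) = c"
    by (simp add: s_def sgn_if flip: power2_eq_square)
  ultimately show ?thesis
    by (intro that[of s "sgn c * s"]) (auto simp: heis_eq_iff c_def sgn_if abs_mult field_simps)
qed

text \<open>Along the factorization the mean value theorem on each segment uses derivatives in the
  directions \<open>X1\<close> and \<open>X2\<close> only, and the contributions of the commutator cancel up to the error.\<close>

lemma Gamma1_expansion: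
  assumes \<psi>: "Gamma1 T \<psi>" and t0: "t0 \<in> {0<..<T}" and \<epsilon>: "0 < \<epsilon>"
  obtains \<rho> where "0 < \<rho>"
    "\<And>t w r. r < \<rho> \<Longrightarrow> \<bar>t - t0\<bar> \<le> r \<Longrightarrow> koranyi w \<le> r \<Longrightarrow>
       \<bar>\<psi> t (hmul x0 w) - \<psi> t0 x0 - deriv (\<lambda>s. \<psi> s x0) t0 * (t - t0)
          - (grad_H (\<psi> t0) x0 $ 1 * w$1 + grad_H (\<psi> t0) x0 $ 2 * w$2)\<bar> \<le> \<epsilon> * r"
proof -
  define q where "q = deriv (\<lambda>s. \<psi> s x0) t0"
  define p where "p = grad_H (\<psi> t0) x0"
  \<comment> \<open>Eleven units of \<open>\<epsilon>' * r\<close>: one for the time step, one each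
    for the segments \<open>w$1\<close> and \<open>w$2\<close>, and two for each of the four
    commutator segments.\<close>
  define \<epsilon>' where "\<epsilon>' = \<epsilon> / 11"
  have \<epsilon>': "0 < \<epsilon>'" using \<epsilon> by (simp add: \<epsilon>'_def)
  define D where "D = (\<lambda>(t, x). (deriv (\<lambda>s. \<psi> s x) t, grad_H (\<psi> t) x))"
  have cD: "continuous_on ({0<..<T} \<times> UNIV) D" using \<psi> by (simp add: Gamma1_def D_def)
  have dt: "(\<lambda>s. \<psi> s x) field_differentiable (at t)"
    and d1: "along X1 (\<psi> t) x field_differentiable (at 0)"
    and d2: "along X2 (\<psi> t) x field_differentiable (at 0)" if "t \<in> {0<..<T}" for t x
    using \<psi> that unfolding Gamma1_def by blast+
  have "open ({0<..<T} \<times> (UNIV::heis set))" by (intro open_Times) auto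
  then have "isCont D (t0, x0)" using cD t0 by (simp add: continuous_on_eq_continuous_at)
  then obtain \<delta>1 where \<delta>1: "\<delta>1 > 0" "\<And>z. dist z (t0, x0) < \<delta>1 \<Longrightarrow> dist (D z) (D (t0, x0)) < \<epsilon>'"
    unfolding continuous_at_eps_delta using \<epsilon>' by metis
  have "open {0<..<T}" by simp
  then obtain \<delta>2 where \<delta>2: "\<delta>2 > 0" "\<And>t. dist t t0 < \<delta>2 \<Longrightarrow> t \<in> {0<..<T}"
    using t0 unfolding open_dist by metis
  have "continuous_on UNIV (hmul x0)" by (intro continuous_on_hmul continuous_intros)
  then have "isCont (hmul x0) 0" by (simp add: continuous_on_eq_continuous_at)
  then obtain \<delta>3 where \<delta>3: "\<delta>3 > 0" "\<And>v. dist v 0 < \<delta>3 \<Longrightarrow> dist (hmul x0 v) (hmul x0 0) < \<delta>1 / 2"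
    unfolding continuous_at_eps_delta using \<delta>1(1) by (metis half_gt_zero)
  \<comment> \<open>\<open>\<delta>1\<close> is shared equally by time and space,
    \<open>\<delta>2\<close> keeps the times inside \<open>(0,T)\<close>, and 168 converts
    \<open>near\<close> into a Euclidean bound below \<open>\<delta>3\<close>.\<close>
  define \<rho> where "\<rho> = min (min (\<delta>1 / 2) \<delta>2) (min (\<delta>3 / 168) 1)"
  have \<rho>: "0 < \<rho>" using \<delta>1 \<delta>2 \<delta>3 by (simp add: \<rho>_def)
  have main: "\<bar>\<psi> t (hmul x0 w) - \<psi> t0 x0 - q * (t - t0) - (p $ 1 * w$1 + p $ 2 * w$2)\<bar> \<le> \<epsilon> * r"
    if r: "r < \<rho>" and t: "\<bar>t - t0\<bar> \<le> r" and w: "koranyi w \<le> r" for t w r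
  proof -
    have r0: "0 \<le> r" using t by linarith
    have rb: "r < \<delta>1 / 2" "r < \<delta>2" "r < \<delta>3 / 168" "r \<le> 1" using r by (auto simp: \<rho>_def)
    have D: "\<bar>deriv (\<lambda>s. \<psi> s x) t' - q\<bar> \<le> \<epsilon>'" "\<bar>grad_H (\<psi> t') x $ i - p $ i\<bar> \<le> \<epsilon>'"
      if "\<bar>t' - t0\<bar> \<le> r" "dist x x0 < \<delta>1 / 2" for t' x i
    proof -
      have "dist (t', x) (t0, x0) \<le> \<bar>t' - t0\<bar> + dist x x0"
        unfolding dist_Pair_Pair dist_real_def by (rule order_trans[OF sqrt_sum_squares_le_sum_abs]) simp
      then have "dist (t', x) (t0, x0) < \<delta>1" using that rb by linarith
      from \<delta>1(2)[OF this] have d: "dist (D (t', x)) (D (t0, x0)) < \<epsilon>'" .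
      have "dist (deriv (\<lambda>s. \<psi> s x) t') q < \<epsilon>'" "dist (grad_H (\<psi> t') x) p < \<epsilon>'"
        using le_less_trans[OF dist_fst_le d] le_less_trans[OF dist_snd_le d]
        by (simp_all add: D_def q_def p_def)
      moreover have "\<bar>(grad_H (\<psi> t') x - p) $ i\<bar> \<le> dist (grad_H (\<psi> t') x) p"
        unfolding dist_norm by (rule component_le_norm_cart)
      ultimately show "\<bar>deriv (\<lambda>s. \<psi> s x) t' - q\<bar> \<le> \<epsilon>'" "\<bar>grad_H (\<psi> t') x $ i - p $ i\<bar> \<le> \<epsilon>'"
        by (auto simp: dist_real_def)
    qed
    have tT: "t' \<in> {0<..<T}" if "\<bar>t' - t0\<bar> \<le> r" for t'
      using that rb by (intro \<delta>2) (auto simp: dist_real_def)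
    have time: "\<bar>\<psi> t x0 - \<psi> t0 x0 - q * (t - t0)\<bar> \<le> \<epsilon>' * \<bar>t - t0\<bar>"
    proof (rule real_diff_bound[where f="\<lambda>s. \<psi> s x0" and f'="\<lambda>s. deriv (\<lambda>s. \<psi> s x0) s"])
      fix s assume "s \<in> closed_segment t0 t"
      then have s: "\<bar>s - t0\<bar> \<le> r" using t by (auto simp: closed_segment_eq_real_ivl split: if_splits)
      show "((\<lambda>s. \<psi> s x0) has_field_derivative deriv (\<lambda>s. \<psi> s x0) s) (at s)"
        using dt[OF tT[OF s]] field_differentiable_derivI by blast
      show "\<bar>deriv (\<lambda>s. \<psi> s x0) s - q\<bar> \<le> \<epsilon>'" using D(1)[OF s, of x0] \<delta>1 by simp
    qed
    have nr: "dist (hmul x0 v) x0 < \<delta>1 / 2" if "near k r v" "k \<le> 6" "0 \<le> k" for k v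
      using \<delta>3(2)[of v] near_norm_le[OF that r0 rb(4)] rb(3) by simp
    have s1: "\<bar>\<psi> t (hmul x0 (hmul v (e1 s))) - \<psi> t (hmul x0 v) - p$1 * s\<bar> \<le> \<epsilon>' * \<bar>s\<bar>"
      and s2: "\<bar>\<psi> t (hmul x0 (hmul v (e2 s))) - \<psi> t (hmul x0 v) - p$2 * s\<bar> \<le> \<epsilon>' * \<bar>s\<bar>"
      if v: "near k r v" "k \<le> 5" "0 \<le> k" and s: "\<bar>s\<bar> \<le> 2 * r" for k v s
    proof -
      have n: "dist (hmul x0 (hmul v (e1 s'))) x0 < \<delta>1 / 2" "dist (hmul x0 (hmul v (e2 s'))) x0 < \<delta>1 / 2"
        if "\<bar>s'\<bar> \<le> \<bar>s\<bar>" for s'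
        using nr[OF near_step(1)[OF v(1) order_trans[OF that s] v(3)]]
          nr[OF near_step(2)[OF v(1) order_trans[OF that s] v(3)]] v by auto
      show "\<bar>\<psi> t (hmul x0 (hmul v (e1 s))) - \<psi> t (hmul x0 v) - p$1 * s\<bar> \<le> \<epsilon>' * \<bar>s\<bar>"
      proof -
        have "\<bar>\<psi> t (hmul x0 v + s *\<^sub>R X1 (hmul x0 v)) - \<psi> t (hmul x0 v) - p$1 * s\<bar> \<le> \<epsilon>' * \<bar>s\<bar>"
        proof (rule along_diff_bound[OF X1_flow(2) d1[OF tT[OF t]]])
          fix s' assume "\<bar>s'\<bar> \<le> \<bar>s\<bar>"
          from D(2)[OF t n(1)[OF this], of 1]
          show "\<bar>deriv (along X1 (\<psi> t) (hmul x0 v + s' *\<^sub>R X1 (hmul x0 v))) 0 - p$1\<bar> \<le> \<epsilon>'"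
            by (simp add: X1_flow(1) grad_H_nth hmul_assoc)
        qed
        then show ?thesis by (simp add: X1_flow(1) hmul_assoc)
      qed
      show "\<bar>\<psi> t (hmul x0 (hmul v (e2 s))) - \<psi> t (hmul x0 v) - p$2 * s\<bar> \<le> \<epsilon>' * \<bar>s\<bar>"
      proof -
        have "\<bar>\<psi> t (hmul x0 v + s *\<^sub>R X2 (hmul x0 v)) - \<psi> t (hmul x0 v) - p$2 * s\<bar> \<le> \<epsilon>' * \<bar>s\<bar>"
        proof (rule along_diff_bound[OF X2_flow(2) d2[OF tT[OF t]]])
          fix s' assume "\<bar>s'\<bar> \<le> \<bar>s\<bar>"
          from D(2)[OF t n(2)[OF this], of 2]
          show "\<bar>deriv (along X2 (\<psi> t) (hmul x0 v + s' *\<^sub>R X2 (hmul x0 v))) 0 - p$2\<bar> \<le> \<epsilon>'"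
            by (simp add: X2_flow(1) grad_H_nth hmul_assoc)
        qed
        then show ?thesis by (simp add: X2_flow(1) hmul_assoc)
      qed
    qed
    obtain s \<sigma> where s: "\<bar>s\<bar> \<le> 2 * r" "\<bar>\<sigma>\<bar> \<le> 2 * r" and
      w_eq: "w = hmul (hmul (hmul (hmul (hmul (e1 (w$1)) (e2 (w$2))) (e1 s)) (e2 \<sigma>)) (e1 (- s))) (e2 (- \<sigma>))"
      using horizontal_factorization[OF w] by blast
    have ab: "\<bar>w$1\<bar> \<le> r" "\<bar>w$2\<bar> \<le> r" using koranyi_coords[of w] w by linarith+
    then have ab': "\<bar>w$1\<bar> \<le> 2 * r" "\<bar>w$2\<bar> \<le> 2 * r" "\<bar>- s\<bar> \<le> 2 * r" "\<bar>- \<sigma>\<bar> \<le> 2 * r" using r0 s by auto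
    define v1 where "v1 = hmul 0 (e1 (w$1))"
    define v2 where "v2 = hmul v1 (e2 (w$2))"
    define v3 where "v3 = hmul v2 (e1 s)"
    define v4 where "v4 = hmul v3 (e2 \<sigma>)"
    define v5 where "v5 = hmul v4 (e1 (- s))"
    have w6: "w = hmul v5 (e2 (- \<sigma>))"
      using w_eq unfolding v5_def v4_def v3_def v2_def v1_def by simp
    have n0: "near 0 r 0" by (simp add: near_def)
    have n1: "near 1 r v1" using near_step(1)[OF n0 ab'(1)] by (simp add: v1_def del: hmul_0)
    have n2: "near 2 r v2" using near_step(2)[OF n1 ab'(2)] by (simp add: v2_def)
    have n3: "near 3 r v3" using near_step(1)[OF n2 s(1)] by (simp add: v3_def)
    have n4: "near 4 r v4" using near_step(2)[OF n3 s(2)] by (simp add: v4_def)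
    have n5: "near 5 r v5" using near_step(1)[OF n4 ab'(3)] by (simp add: v5_def)
    let ?\<psi> = "\<lambda>v. \<psi> t (hmul x0 v)"
    have tri: "\<bar>a1 + a2 + a3 + a4 + a5 + a6\<bar> \<le> b1 + b2 + b3 + b4 + b5 + b6"
      if "\<bar>a1\<bar> \<le> b1" "\<bar>a2\<bar> \<le> b2" "\<bar>a3\<bar> \<le> b3" "\<bar>a4\<bar> \<le> b4" "\<bar>a5\<bar> \<le> b5" "\<bar>a6\<bar> \<le> b6"
      for a1 a2 a3 a4 a5 a6 b1 b2 b3 b4 b5 b6 :: real
      using that unfolding abs_le_iff by linarith
    have "?\<psi> w - \<psi> t x0 - (p $ 1 * w$1 + p $ 2 * w$2)
        = (?\<psi> v1 - ?\<psi> 0 - p$1 * w$1) + (?\<psi> v2 - ?\<psi> v1 - p$2 * w$2) + (?\<psi> v3 - ?\<psi> v2 - p$1 * s)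
          + (?\<psi> v4 - ?\<psi> v3 - p$2 * \<sigma>) + (?\<psi> v5 - ?\<psi> v4 - p$1 * (- s)) + (?\<psi> w - ?\<psi> v5 - p$2 * (- \<sigma>))"
      by simp
    also have "\<bar>\<dots>\<bar> \<le> \<epsilon>' * \<bar>w$1\<bar> + \<epsilon>' * \<bar>w$2\<bar> + \<epsilon>' * \<bar>s\<bar> + \<epsilon>' * \<bar>\<sigma>\<bar> + \<epsilon>' * \<bar>- s\<bar> + \<epsilon>' * \<bar>- \<sigma>\<bar>"
      by (rule tri; rule s1[OF n0 _ _ ab'(1), folded v1_def] s2[OF n1 _ _ ab'(2), folded v2_def]
        s1[OF n2 _ _ s(1), folded v3_def] s2[OF n3 _ _ s(2), folded v4_def]
        s1[OF n4 _ _ ab'(3), folded v5_def] s2[OF n5 _ _ ab'(4), folded w6]; simp)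
    also have "\<dots> \<le> \<epsilon>' * r + \<epsilon>' * r + \<epsilon>' * (2 * r) + \<epsilon>' * (2 * r) + \<epsilon>' * (2 * r) + \<epsilon>' * (2 * r)"
      using \<epsilon>' ab s by (intro add_mono mult_left_mono) auto
    finally have "\<bar>\<psi> t (hmul x0 w) - \<psi> t x0 - (p $ 1 * w$1 + p $ 2 * w$2)\<bar> \<le> 10 * (\<epsilon>' * r)"
      by simp
    moreover have "\<epsilon>' * \<bar>t - t0\<bar> \<le> \<epsilon>' * r" using \<epsilon>' t by (intro mult_left_mono) auto
    ultimately have "\<bar>\<psi> t (hmul x0 w) - \<psi> t0 x0 - q * (t - t0) - (p $ 1 * w$1 + p $ 2 * w$2)\<bar> \<le> 11 * (\<epsilon>' * r)"
      using time by linarith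
    then show ?thesis by (simp add: \<epsilon>'_def)
  qed
  show ?thesis by (rule that[OF \<rho>]) (use main in \<open>auto simp: q_def p_def\<close>)
qed

section \<open>The Hamiltonian and the viscosity inequalities\<close>

text \<open>\<open>GREATEST\<close> has the intended meaning only if a greatest value exists, which
  compactness and continuity provide.\<close>

lemma max_over_attained:
  assumes "compact A" "A \<noteq> {}" "continuous_on A f"
  obtains a where "a \<in> A" "max_over A f = f a" "\<And>b. b \<in> A \<Longrightarrow> f b \<le> f a"
proof -
  obtain a where a: "a \<in> A" "\<forall>b\<in>A. f b \<le> f a" using continuous_attains_sup[OF assms] by blast
  then have "max_over A f = f a" unfolding max_over_def by (intro Greatest_equality) auto
  with a that show ?thesis by blast
qed

lemma min_over_attained:
  assumes "compact A" "A \<noteq> {}" "continuous_on A f"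
  obtains a where "a \<in> A" "min_over A f = f a" "\<And>b. b \<in> A \<Longrightarrow> f a \<le> f b"
proof -
  obtain a where a: "a \<in> A" "\<forall>b\<in>A. f a \<le> f b" using continuous_attains_inf[OF assms] by blast
  then have "min_over A f = f a" unfolding min_over_def by (intro Least_equality) auto
  with a that show ?thesis by blast
qed

text \<open>Taking a maximum is 1-Lipschitz for the uniform distance: compare the two functions at
  the maximizer of each.\<close>

lemma max_over_diff:
  assumes "compact A" "A \<noteq> {}" "continuous_on A f" "continuous_on A g"
    and d: "\<And>a. a \<in> A \<Longrightarrow> \<bar>f a - g a\<bar> \<le> e"
  shows "\<bar>max_over A f - max_over A g\<bar> \<le> e"
proof -
  obtain a where a: "a \<in> A" "max_over A f = f a" "\<And>b. b \<in> A \<Longrightarrow> f b \<le> f a"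
    using max_over_attained assms(1-3) by blast
  obtain b where b: "b \<in> A" "max_over A g = g b" "\<And>c. c \<in> A \<Longrightarrow> g c \<le> g b"
    using max_over_attained assms(1,2,4) by blast
  show ?thesis using a b(2) a(3)[OF b(1)] b(3)[OF a(1)] d[OF a(1)] d[OF b(1)] by linarith
qed

lemma min_over_diff:
  assumes "compact A" "A \<noteq> {}" "continuous_on A f" "continuous_on A g"
    and d: "\<And>a. a \<in> A \<Longrightarrow> \<bar>f a - g a\<bar> \<le> e"
  shows "\<bar>min_over A f - min_over A g\<bar> \<le> e"
proof -
  obtain a where a: "a \<in> A" "min_over A f = f a" "\<And>b. b \<in> A \<Longrightarrow> f a \<le> f b"
    using min_over_attained assms(1-3) by blast
  obtain b where b: "b \<in> A" "min_over A g = g b" "\<And>c. c \<in> A \<Longrightarrow> g b \<le> g c"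
    using min_over_attained assms(1,2,4) by blast
  show ?thesis using a b(2) a(3)[OF b(1)] b(3)[OF a(1)] d[OF a(1)] d[OF b(1)] by linarith
qed

text \<open>The inequality is strict and \<open>f\<close> is continuous in \<open>z\<close>, so
  candidates from a countable dense subset of \<open>Z\<close> suffice. For a fixed candidate the
  admissible \<open>y\<close> form a relatively open part of the closed set \<open>Y\<close>, hence
  a Borel set, and the least admissible index is a Borel function.\<close>

lemma measurable_selection_less:
  fixes f :: "real^2 \<Rightarrow> real^2 \<Rightarrow> real"
  assumes Y: "closed Y" and Z: "Z \<noteq> {}"
    and fy: "\<And>z. z \<in> Z \<Longrightarrow> continuous_on Y (\<lambda>y. f y z)"
    and fz: "\<And>y. y \<in> Y \<Longrightarrow> continuous_on Z (f y)"
    and ex: "\<And>y. y \<in> Y \<Longrightarrow> \<exists>z\<in>Z. f y z < c"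
  obtains \<zeta> where "\<zeta> \<in> borel_measurable borel" "\<And>y. \<zeta> y \<in> Z" "\<And>y. y \<in> Y \<Longrightarrow> f y (\<zeta> y) < c"
proof -
  obtain D where D: "countable D" "D \<subseteq> Z" "Z \<subseteq> closure D" using separable by blast
  with Z have "D \<noteq> {}" by auto
  define d where "d = from_nat_into D"
  have rd: "range d = D" unfolding d_def using \<open>D \<noteq> {}\<close> D(1) by (rule range_from_nat_into)
  have dZ: "d n \<in> Z" for n using rd D by blast
  have ex': "\<exists>n. f y (d n) < c" if y: "y \<in> Y" for y
  proof -
    obtain z where z: "z \<in> Z" "f y z < c" using ex[OF y] by blast
    obtain \<delta> where \<delta>: "0 < \<delta>" "\<And>z'. z' \<in> Z \<Longrightarrow> dist z' z < \<delta> \<Longrightarrow> dist (f y z') (f y z) < c - f y z"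
      using fz[OF y] z unfolding continuous_on_iff by (metis diff_gt_0_iff_gt)
    obtain z' where "z' \<in> D" "dist z' z < \<delta>"
      using z(1) D(3) \<delta>(1) closure_approachable by blast
    with \<delta>(2)[of z'] D(2) have "f y z' < c" by (auto simp: dist_real_def)
    with \<open>z' \<in> D\<close> rd show ?thesis by (metis imageE)
  qed
  \<comment> \<open>Off \<open>Y\<close> no index satisfies the condition and the value of
    \<open>LEAST\<close> is unspecified; the selection still lies in \<open>Z\<close> because every
    \<open>d n\<close> does.\<close>
  define N where "N y = (LEAST n. y \<in> Y \<and> f y (d n) < c)" for y
  have N: "N \<in> measurable borel (count_space UNIV)"
    unfolding N_def[abs_def]
  proof (rule measurable_Least)
    fix n
    have "openin (top_of_set Y) (Y \<inter> (\<lambda>y. f y (d n)) -` {..<c})"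
      by (rule continuous_openin_preimage_gen[OF fy[OF dZ]]) auto
    then obtain U where U: "open U" "Y \<inter> (\<lambda>y. f y (d n)) -` {..<c} = U \<inter> Y"
      unfolding openin_open by blast
    have "U \<inter> Y \<in> sets borel" using U(1) Y by auto
    moreover have "{y. y \<in> Y \<and> f y (d n) < c} = U \<inter> Y" using U(2) by auto
    ultimately have "{y. y \<in> Y \<and> f y (d n) < c} \<in> sets borel" by simp
    then show "(\<lambda>y. y \<in> Y \<and> f y (d n) < c) \<in> measurable borel (count_space UNIV)"
      by (simp add: pred_def)
  qed
  show ?thesis
  proof (rule that[of "\<lambda>y. d (N y)"])
    show "(\<lambda>y. d (N y)) \<in> borel_measurable borel"
      by (rule measurable_compose[OF N]) simp
    fix y assume y: "y \<in> Y"
    then have "\<exists>n. y \<in> Y \<and> f y (d n) < c" using ex' by blast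
    from LeastI_ex[OF this] show "f y (d (N y)) < c" unfolding N_def by blast
  qed (rule dZ)
qed

lemma eventually_nhds_gauge:
  fixes t0 :: real
  assumes "\<forall>\<^sub>F (t, x) in nhds (t0, x0). P t x"
  obtains \<eta> where "0 < \<eta>" "\<And>t w r. r < \<eta> \<Longrightarrow> \<bar>t - t0\<bar> \<le> r \<Longrightarrow> koranyi w \<le> r \<Longrightarrow> P t (hmul x0 w)"
proof -
  have "continuous_on UNIV (\<lambda>p::real \<times> heis. (fst p, hmul x0 (snd p)))"
    by (intro continuous_on_Pair continuous_on_hmul continuous_on_fst continuous_on_snd continuous_on_id continuous_on_const)
  then have "isCont (\<lambda>p. (fst p, hmul x0 (snd p))) (t0, 0)"
    by (simp add: continuous_on_eq_continuous_at)
  then have "filterlim (\<lambda>p. (fst p, hmul x0 (snd p))) (nhds (t0, x0)) (nhds (t0, 0))"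
    using tendsto_at_iff_tendsto_nhds[of "\<lambda>p. (fst p, hmul x0 (snd p))" "(t0, 0)"]
    by (simp add: isCont_def)
  then have "\<forall>\<^sub>F p in nhds (t0, 0). P (fst p) (hmul x0 (snd p))"
    using assms unfolding filterlim_iff by (auto simp: case_prod_unfold)
  then obtain \<delta> where \<delta>: "0 < \<delta>" "\<And>p. dist p (t0, 0) < \<delta> \<Longrightarrow> P (fst p) (hmul x0 (snd p))"
    unfolding eventually_nhds_metric by blast
  show ?thesis
  \<comment> \<open>For \<open>r \<le> 1\<close> the norm of \<open>w\<close> is at most
    \<open>r + r + r\<^sup>2 \<le> 3 * r\<close>; with the time difference this makes
    \<open>4 * r\<close>.\<close>
  proof (rule that[of "min 1 (\<delta> / 4)"])
    show "0 < min 1 (\<delta> / 4)" using \<delta> by simp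
    fix t w r assume r: "r < min 1 (\<delta> / 4)" "\<bar>t - t0\<bar> \<le> r" "koranyi w \<le> r"
    have r0: "0 \<le> r" using r by linarith
    have "(koranyi w)\<^sup>2 \<le> r\<^sup>2" using r by (intro power_mono) auto
    also have "r\<^sup>2 \<le> r" using r0 r power_decreasing[of 1 2 r] by simp
    finally have "norm w \<le> 3 * r"
      using koranyi_coords[of w] r norm_le_l1_cart[of w] by (simp add: sum_3)
    moreover have "dist (t, w) (t0, 0) \<le> \<bar>t - t0\<bar> + norm w"
      unfolding dist_Pair_Pair dist_real_def by (rule order_trans[OF sqrt_sum_squares_le_sum_abs]) simp
    ultimately show "P t (hmul x0 w)" using \<delta>(2)[of "(t, w)"] r by simp
  qed
qed

section \<open>Attainment and continuity of the Hamiltonian\<close>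

context heis_game
begin

lemma compact_sets: "compact Y" "compact Z" "Y \<noteq> {}" "Z \<noteq> {}"
proof -
  have "Y = cball 0 RY" "Z = cball 0 RZ" by (auto simp: Y Z)
  then show "compact Y" "compact Z" by simp_all
qed (use zero_in in auto)

abbreviation "H \<equiv> lower_hamiltonian Y Z F"

lemma F_cont_z: "t \<in> {0..T} \<Longrightarrow> y \<in> Y \<Longrightarrow> continuous_on Z (\<lambda>z. F t x y z - p \<bullet> z)"
  and F_cont_y: "t \<in> {0..T} \<Longrightarrow> z \<in> Z \<Longrightarrow> continuous_on Y (\<lambda>y. F t x y z - p \<bullet> z)"
proof -
  assume t: "t \<in> {0..T}"
  show "continuous_on Z (\<lambda>z. F t x y z - p \<bullet> z)" if "y \<in> Y"
  proof (intro continuous_on_diff continuous_on_inner continuous_on_const continuous_on_id)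
    have "continuous_on Z (\<lambda>z. case (t, x, y, z) of (t, x, y, z) \<Rightarrow> F t x y z)"
      by (rule continuous_on_compose2[OF F_cont])
         (use t that in \<open>auto intro!: continuous_on_Pair continuous_on_const continuous_on_id\<close>)
    then show "continuous_on Z (\<lambda>z. F t x y z)" by simp
  qed
  show "continuous_on Y (\<lambda>y. F t x y z - p \<bullet> z)" if "z \<in> Z"
  proof (intro continuous_on_diff continuous_on_inner continuous_on_const continuous_on_id)
    have "continuous_on Y (\<lambda>y. case (t, x, y, z) of (t, x, y, z) \<Rightarrow> F t x y z)"
      by (rule continuous_on_compose2[OF F_cont])
         (use t that in \<open>auto intro!: continuous_on_Pair continuous_on_const continuous_on_id\<close>)
    then show "continuous_on Y (\<lambda>y. F t x y z)" by simp
  qed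
qed

text \<open>Uniformity in \<open>z\<close> is what matters: it lets \<open>F\<close> be frozen at
  one point along a trajectory and the inner minima be compared at equal \<open>z\<close>.\<close>

lemma F_near:
  assumes "0 < e"
  obtains \<delta> where "0 < \<delta>" "\<And>t x y t' x' y' z. t \<in> {0..T} \<Longrightarrow> t' \<in> {0..T} \<Longrightarrow> y \<in> Y \<Longrightarrow> y' \<in> Y \<Longrightarrow> z \<in> Z \<Longrightarrow>
    \<bar>t - t'\<bar> + dG x x' + dist y y' < \<delta> \<Longrightarrow> \<bar>F t x y z - F t' x' y' z\<bar> < e"
proof -
  obtain \<delta> where \<delta>: "\<delta> > 0" "\<forall>p\<in>{0..T} \<times> UNIV \<times> Y \<times> Z. \<forall>q\<in>{0..T} \<times> UNIV \<times> Y \<times> Z. dist_txyz p q < \<delta> \<longrightarrow>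
      \<bar>(case p of (t, x, y, z) \<Rightarrow> F t x y z) - (case q of (t, x, y, z) \<Rightarrow> F t x y z)\<bar> < e"
    using F_uc assms unfolding unif_cont_wrt_def by blast
  show ?thesis
  proof (rule that[OF \<delta>(1)])
    fix t x y t' x' y' z
    assume "t \<in> {0..T}" "t' \<in> {0..T}" "y \<in> Y" "y' \<in> Y" "z \<in> Z" "\<bar>t - t'\<bar> + dG x x' + dist y y' < \<delta>"
    then show "\<bar>F t x y z - F t' x' y' z\<bar> < e"
      using \<delta>(2)[rule_format, of "(t, x, y, z)" "(t', x', y', z)"] by (simp add: dist_txyz_def)
  qed
qed

text \<open>Ensures that the outer maximum in the Hamiltonian is attained.\<close>

lemma min_cont:
  assumes t: "t \<in> {0..T}"
  shows "continuous_on Y (\<lambda>y. min_over Z (\<lambda>z. F t x y z - p \<bullet> z))"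
  unfolding continuous_on_iff
proof (intro ballI allI impI)
  fix y and e :: real assume y: "y \<in> Y" and e: "0 < e"
  then have "0 < e / 2" by simp
  from F_near[OF this] obtain \<delta> where \<delta>: "0 < \<delta>" and
    n: "\<And>t x y t' x' y' z. t \<in> {0..T} \<Longrightarrow> t' \<in> {0..T} \<Longrightarrow> y \<in> Y \<Longrightarrow> y' \<in> Y \<Longrightarrow> z \<in> Z \<Longrightarrow>
    \<bar>t - t'\<bar> + dG x x' + dist y y' < \<delta> \<Longrightarrow> \<bar>F t x y z - F t' x' y' z\<bar> < e / 2" by blast
  have "dist (min_over Z (\<lambda>z. F t x y' z - p \<bullet> z)) (min_over Z (\<lambda>z. F t x y z - p \<bullet> z)) < e"
    if "y' \<in> Y" "dist y' y < \<delta>" for y'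
  proof -
    have "\<bar>min_over Z (\<lambda>z. F t x y' z - p \<bullet> z) - min_over Z (\<lambda>z. F t x y z - p \<bullet> z)\<bar> \<le> e / 2"
    proof (rule min_over_diff[OF compact_sets(2,4) F_cont_z[OF t that(1)] F_cont_z[OF t y]])
      fix z assume "z \<in> Z"
      from n[OF t t that(1) y this, of x x] that(2)
      show "\<bar>F t x y' z - p \<bullet> z - (F t x y z - p \<bullet> z)\<bar> \<le> e / 2" by simp
    qed
    then show ?thesis using e by (simp add: dist_real_def)
  qed
  with \<delta> show "\<exists>d>0. \<forall>x'\<in>Y. dist x' y < d \<longrightarrow>
      dist (min_over Z (\<lambda>z. F t x x' z - p \<bullet> z)) (min_over Z (\<lambda>z. F t x y z - p \<bullet> z)) < e" by blast
qed

text \<open>The reply \<open>z\<close> may depend on \<open>y\<close>, as a strategy permits; this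
  supplies the existence premise of the measurable selection.\<close>

lemma H_less:
  assumes t: "t \<in> {0..T}" and c: "H t x p < c" and y: "y \<in> Y"
  shows "\<exists>z\<in>Z. F t x y z - p \<bullet> z < c"
proof -
  let ?m = "\<lambda>y. min_over Z (\<lambda>z. F t x y z - p \<bullet> z)"
  obtain a where "max_over Y ?m = ?m a" "\<And>b. b \<in> Y \<Longrightarrow> ?m b \<le> ?m a"
    using max_over_attained[OF compact_sets(1,3) min_cont[OF t]] by blast
  with y c have m: "?m y < c" unfolding lower_hamiltonian_def by force
  obtain z where "z \<in> Z" "?m y = F t x y z - p \<bullet> z"
    using min_over_attained[OF compact_sets(2,4) F_cont_z[OF t y]] by blast
  with m show ?thesis by auto
qed

text \<open>Here the order of the quantifiers is reversed: one \<open>y\<close> works against all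
  \<open>z\<close>, so it can be played as a constant without knowing the strategy of the
  opponent.\<close>

lemma H_greater:
  assumes t: "t \<in> {0..T}" and c: "c < H t x p"
  shows "\<exists>y\<in>Y. \<forall>z\<in>Z. c < F t x y z - p \<bullet> z"
proof -
  let ?m = "\<lambda>y. min_over Z (\<lambda>z. F t x y z - p \<bullet> z)"
  obtain y where y: "y \<in> Y" "max_over Y ?m = ?m y"
    using max_over_attained[OF compact_sets(1,3) min_cont[OF t]] by blast
  with c have m: "c < ?m y" unfolding lower_hamiltonian_def by force
  obtain a where a: "?m y = F t x y a - p \<bullet> a" "\<And>b. b \<in> Z \<Longrightarrow> F t x y a - p \<bullet> a \<le> F t x y b - p \<bullet> b"
    using min_over_attained[OF compact_sets(2,4) F_cont_z[OF t y(1)]] by blast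
  have "\<forall>z\<in>Z. c < F t x y z - p \<bullet> z" using m a by force
  with y(1) show ?thesis by blast
qed

text \<open>Both extrema are 1-Lipschitz for the uniform distance, so the bound for the integrand
  passes through them: \<open>e / 4\<close> from \<open>F\<close> and \<open>e / 4\<close> from
  \<open>p\<close>, the latter by Cauchy-Schwarz and \<open>norm z \<le> RZ\<close>.\<close>

lemma H_cont: "continuous_on ({0..T} \<times> UNIV \<times> UNIV) (\<lambda>(t, x, p). H t x p)"
  unfolding continuous_on_def tendsto_iff
proof (intro ballI allI impI)
  let ?S = "{0..T} \<times> (UNIV::heis set) \<times> (UNIV::(real^2) set)"
  fix u and e :: real assume u: "u \<in> ?S" and e: "0 < e"
  obtain t x p where u_eq: "u = (t, x, p)" by (cases u) auto
  have t: "t \<in> {0..T}" using u by (simp add: u_eq)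
  have "0 < e / 4" using e by simp
  from F_near[OF this] obtain \<delta> where \<delta>: "0 < \<delta>" and
    n: "\<And>t x y t' x' y' z. t \<in> {0..T} \<Longrightarrow> t' \<in> {0..T} \<Longrightarrow> y \<in> Y \<Longrightarrow> y' \<in> Y \<Longrightarrow> z \<in> Z \<Longrightarrow>
    \<bar>t - t'\<bar> + dG x x' + dist y y' < \<delta> \<Longrightarrow> \<bar>F t x y z - F t' x' y' z\<bar> < e / 4" by blast
  have H: "\<bar>H t' x' p' - H t x p\<bar> < e"
    if t': "t' \<in> {0..T}" and d: "\<bar>t' - t\<bar> + dG x' x < \<delta>" and p: "norm (p' - p) * RZ < e / 4" for t' x' p'
  proof -
    have "\<bar>H t' x' p' - H t x p\<bar> \<le> e / 2"
      unfolding lower_hamiltonian_def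
    proof (rule max_over_diff[OF compact_sets(1,3) min_cont[OF t'] min_cont[OF t]])
      fix y assume y: "y \<in> Y"
      show "\<bar>min_over Z (\<lambda>z. F t' x' y z - p' \<bullet> z) - min_over Z (\<lambda>z. F t x y z - p \<bullet> z)\<bar> \<le> e / 2"
      proof (rule min_over_diff[OF compact_sets(2,4) F_cont_z[OF t' y] F_cont_z[OF t y]])
        fix z assume z: "z \<in> Z"
        have 1: "\<bar>F t' x' y z - F t x y z\<bar> < e / 4" by (rule n[OF t' t y y z]) (use d in simp)
        have "\<bar>(p' - p) \<bullet> z\<bar> \<le> norm (p' - p) * norm z" by (rule Cauchy_Schwarz_ineq2)
        also have "\<dots> \<le> norm (p' - p) * RZ" using z by (intro mult_left_mono) (auto simp: Z)
        finally show "\<bar>F t' x' y z - p' \<bullet> z - (F t x y z - p \<bullet> z)\<bar> \<le> e / 2"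
          using p 1 unfolding inner_diff_left by linarith
      qed
    qed
    then show ?thesis using e by simp
  qed
  have cont: "continuous_on UNIV (\<lambda>v. \<bar>fst v - t\<bar> + dG (fst (snd v)) x)"
    "continuous_on UNIV (\<lambda>v::real \<times> heis \<times> (real^2). norm (snd (snd v) - p) * RZ)"
    by (intro continuous_on_add continuous_on_dG continuous_intros)+
  have "((\<lambda>v. \<bar>fst v - t\<bar> + dG (fst (snd v)) x) \<longlongrightarrow> \<bar>fst u - t\<bar> + dG (fst (snd u)) x) (at u within ?S)"
    "((\<lambda>v. norm (snd (snd v) - p) * RZ) \<longlongrightarrow> norm (snd (snd u) - p) * RZ) (at u within ?S)"
    using continuous_on_subset[OF cont(1), of ?S] continuous_on_subset[OF cont(2), of ?S] u
    unfolding continuous_on_def by auto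
  then have lim: "((\<lambda>v. \<bar>fst v - t\<bar> + dG (fst (snd v)) x) \<longlongrightarrow> 0) (at u within ?S)"
    "((\<lambda>v. norm (snd (snd v) - p) * RZ) \<longlongrightarrow> 0) (at u within ?S)"
    by (simp_all add: u_eq)
  have "\<forall>\<^sub>F v in at u within ?S. \<bar>fst v - t\<bar> + dG (fst (snd v)) x < \<delta>"
    by (rule order_tendstoD(2)[OF lim(1) \<delta>])
  moreover have "\<forall>\<^sub>F v in at u within ?S. norm (snd (snd v) - p) * RZ < e / 4"
    by (rule order_tendstoD(2)[OF lim(2)]) (use e in simp)
  moreover have "\<forall>\<^sub>F v in at u within ?S. v \<in> ?S" by (simp add: eventually_at_filter)
  ultimately show "\<forall>\<^sub>F v in at u within ?S. dist (case v of (t, x, p) \<Rightarrow> H t x p) (case u of (t, x, p) \<Rightarrow> H t x p) < e"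
    by eventually_elim (auto simp: u_eq dist_real_def H)
qed

lemma V_admissible: "admissible T H g V"
  unfolding admissible_def
proof (intro conjI H_cont V_uniformly_continuous allI V_terminal)
  show "bounded ((\<lambda>(t, x). V t x) ` ({0..T} \<times> UNIV))"
    unfolding bounded_iff using V_bound by (intro exI[of _ bnd]) auto
qed

section \<open>The viscosity inequalities\<close>

text \<open>The first two coordinates of the displacement are exact integrals of the velocity
  \<open>- z\<close>, so the linear term of the expansion becomes an integral over the control
  without error.\<close>

lemma inner_control_integral:
  assumes z: "bdd_meas a b R z"
  shows "((\<lambda>s. p \<bullet> z s) has_integral - (p$1 * hcurve a (\<lambda>s. - z s) b $ 1 + p$2 * hcurve a (\<lambda>s. - z s) b $ 2)) {a..b}"
proof -
  have "((\<lambda>s. p$1 * z s $ 1 + p$2 * z s $ 2) has_integral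
      p$1 * integral {a..b} (\<lambda>s. z s $ 1) + p$2 * integral {a..b} (\<lambda>s. z s $ 2)) {a..b}"
    by (intro has_integral_add has_integral_mult_right integrable_integral bdd_meas_nth_integrable[OF z])
  then show ?thesis by (simp add: inner_vec_def sum_2 hcurve_nth(1,2) add.commute)
qed

text \<open>Gathers the smallness conditions for both viscosity inequalities; \<open>P\<close>
  stands for either ordering of \<open>V\<close> and \<open>\<psi>\<close>. The duration
  \<open>h\<close> is uniform over the controls, since it is fixed before the opponent's control or
  strategy is known.\<close>

lemma local_expansion:
  assumes \<psi>: "Gamma1 T \<psi>" and t0: "t0 \<in> {0<..<T}" and \<theta>: "0 < \<theta>"
    and P: "\<forall>\<^sub>F (t, x) in nhds (t0, x0). P t x"
  obtains h where "0 < h" "t0 + h \<le> T"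
    "\<And>z. bdd_meas t0 T RZ z \<Longrightarrow> P (t0 + h) (trj t0 x0 z (t0 + h))"
    "\<And>z. bdd_meas t0 T RZ z \<Longrightarrow> \<bar>\<psi> (t0 + h) (trj t0 x0 z (t0 + h)) - \<psi> t0 x0 - deriv (\<lambda>s. \<psi> s x0) t0 * h
        + integral {t0..t0 + h} (\<lambda>s. grad_H (\<psi> t0) x0 \<bullet> z s)\<bar> \<le> \<theta> * h"
    "\<And>y z s. bdd_meas t0 T RY y \<Longrightarrow> bdd_meas t0 T RZ z \<Longrightarrow> s \<in> {t0..t0 + h} \<Longrightarrow>
        \<bar>F s (trj t0 x0 z s) (y s) (z s) - F t0 x0 (y s) (z s)\<bar> \<le> \<theta>"
proof -
  \<comment> \<open>During time \<open>h\<close> the clock advances by \<open>h\<close> and the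
    position by gauge at most \<open>2 * RZ * h\<close>. Thus \<open>K * h\<close> dominates each of
    them as well as their sum, and accuracy \<open>\<theta> / K\<close> yields the error
    \<open>\<theta> * h\<close>.\<close>
  define K where "K = 1 + 2 * RZ"
  have K: "1 \<le> K" using RZ by (simp add: K_def)
  have "0 < \<theta> / K" using \<theta> K by simp
  from Gamma1_expansion[OF \<psi> t0 this, of x0] obtain \<rho> where \<rho>: "0 < \<rho>" and exp:
    "\<And>t w r. r < \<rho> \<Longrightarrow> \<bar>t - t0\<bar> \<le> r \<Longrightarrow> koranyi w \<le> r \<Longrightarrow>
       \<bar>\<psi> t (hmul x0 w) - \<psi> t0 x0 - deriv (\<lambda>s. \<psi> s x0) t0 * (t - t0)
          - (grad_H (\<psi> t0) x0 $ 1 * w$1 + grad_H (\<psi> t0) x0 $ 2 * w$2)\<bar> \<le> \<theta> / K * r" by blast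
  from eventually_nhds_gauge[OF P] obtain \<eta> where \<eta>: "0 < \<eta>" and
    near: "\<And>t w r. r < \<eta> \<Longrightarrow> \<bar>t - t0\<bar> \<le> r \<Longrightarrow> koranyi w \<le> r \<Longrightarrow> P t (hmul x0 w)" by blast
  from F_near[OF \<theta>] obtain \<delta> where \<delta>: "0 < \<delta>" and
    Fn: "\<And>t x y t' x' y' z. t \<in> {0..T} \<Longrightarrow> t' \<in> {0..T} \<Longrightarrow> y \<in> Y \<Longrightarrow> y' \<in> Y \<Longrightarrow> z \<in> Z \<Longrightarrow>
    \<bar>t - t'\<bar> + dG x x' + dist y y' < \<delta> \<Longrightarrow> \<bar>F t x y z - F t' x' y' z\<bar> < \<theta>" by blast
  define m where "m = min \<rho> (min \<eta> \<delta>)"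
  have m: "0 < m" using \<rho> \<eta> \<delta> by (simp add: m_def)
  \<comment> \<open>The factor 2 makes \<open>K * h\<close> strictly smaller than
    \<open>m\<close>.\<close>
  define h where "h = min (T - t0) (m / (2 * K))"
  have h: "0 < h" "t0 + h \<le> T" using t0 m K by (auto simp: h_def)
  have "K * h \<le> K * (m / (2 * K))" using K by (intro mult_left_mono) (auto simp: h_def)
  also have "\<dots> < m" using K m by simp
  finally have r: "K * h < \<rho>" "K * h < \<eta>" "K * h < \<delta>" by (auto simp: m_def)
  have hK: "h \<le> K * h" using K h by simp
  have kor: "koranyi (hcurve t0 (\<lambda>s. - z s) (t0 + h)) \<le> K * h" if z: "bdd_meas t0 T RZ z" for z
    using koranyi_hcurve_le[OF bdd_meas_uminus[OF z], of "t0 + h"] h by (simp add: K_def algebra_simps)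
  show ?thesis
  proof (rule that[OF h])
    fix z assume z: "bdd_meas t0 T RZ z"
    show "P (t0 + h) (trj t0 x0 z (t0 + h))"
      unfolding trj_def by (rule near[OF r(2) _ kor[OF z]]) (use h hK in simp)
    have zh: "bdd_meas t0 (t0 + h) RZ z" by (rule bdd_meas_subset[OF z]) (use h in auto)
    have "\<bar>t0 + h - t0\<bar> \<le> K * h" using h hK by simp
    from exp[OF r(1) this kor[OF z]]
    show "\<bar>\<psi> (t0 + h) (trj t0 x0 z (t0 + h)) - \<psi> t0 x0 - deriv (\<lambda>s. \<psi> s x0) t0 * h
        + integral {t0..t0 + h} (\<lambda>s. grad_H (\<psi> t0) x0 \<bullet> z s)\<bar> \<le> \<theta> * h"
      using K by (simp add: trj_def integral_unique[OF inner_control_integral[OF zh]])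
  next
    fix y z s assume y: "bdd_meas t0 T RY y" and z: "bdd_meas t0 T RZ z" and s: "s \<in> {t0..t0 + h}"
    have sT: "s \<in> {t0..T}" using s h by auto
    have "\<bar>s - t0\<bar> + dG (trj t0 x0 z s) x0 \<le> (s - t0) + 2 * RZ * (s - t0)"
      using dG_trj_le[OF z sT, of x0] s by simp
    also have "\<dots> = K * (s - t0)" by (simp add: K_def algebra_simps)
    also have "\<dots> \<le> K * h" using s K by (intro mult_left_mono) auto
    finally have "\<bar>s - t0\<bar> + dG (trj t0 x0 z s) x0 + dist (y s) (y s) < \<delta>" using r by simp
    from Fn[OF _ _ bdd_meas_Y[OF y sT] bdd_meas_Y[OF y sT] bdd_meas_Z[OF z sT] this]
    show "\<bar>F s (trj t0 x0 z s) (y s) (z s) - F t0 x0 (y s) (z s)\<bar> \<le> \<theta>"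
      using sT t0 by (auto simp: less_imp_le)
  qed
qed

lemma V_subsolution: "viscosity_subsolution T H g V"
  unfolding viscosity_subsolution_def
proof (intro conjI V_admissible ballI allI impI; elim conjE)
  fix t0 x0 \<psi>
  assume t0: "t0 \<in> {0<..<T}" and \<psi>: "Gamma1 T \<psi>" and eq: "V t0 x0 = \<psi> t0 x0"
    and le: "\<forall>\<^sub>F (t, x) in nhds (t0, x0). V t x \<le> \<psi> t x"
  define q where "q = deriv (\<lambda>t. \<psi> t x0) t0"
  define p where "p = grad_H (\<psi> t0) x0"
  have t0': "t0 \<in> {0..T}" "0 \<le> t0" using t0 by auto
  show "0 \<le> deriv (\<lambda>t. \<psi> t x0) t0 + H t0 x0 (grad_H (\<psi> t0) x0)"
  proof (rule ccontr)
    assume "\<not> ?thesis"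
    then have neg: "q + H t0 x0 p < 0" by (simp add: q_def p_def)
    \<comment> \<open>The margin is \<open>4 * \<theta>\<close>: one part gives the strict
      inequality for the selection, one pays for freezing \<open>F\<close>, one for the expansion of
      \<open>\<psi>\<close>, and the last remains as the contradiction
      \<open>- \<theta> * h\<close>.\<close>
    define \<theta> where "\<theta> = - (q + H t0 x0 p) / 4"
    have \<theta>: "0 < \<theta>" using neg by (simp add: \<theta>_def)
    have "H t0 x0 p < - q - 3 * \<theta>" using neg unfolding \<theta>_def by argo
    from measurable_selection_less[OF compact_imp_closed[OF compact_sets(1)] compact_sets(4)
        F_cont_y[OF t0'(1)] F_cont_z[OF t0'(1)] H_less[OF t0'(1) this]]
    obtain \<zeta> where \<zeta>: "\<zeta> \<in> borel_measurable borel" "\<And>y. \<zeta> y \<in> Z"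
      and \<zeta>c: "\<And>y. y \<in> Y \<Longrightarrow> F t0 x0 y (\<zeta> y) - p \<bullet> \<zeta> y < - q - 3 * \<theta>" by blast
    \<comment> \<open>Acting pointwise in time makes the strategy nonanticipative; composing the
      Borel function \<open>\<zeta>\<close> with a Lebesgue measurable control gives a Lebesgue
      measurable reply.\<close>
    define \<beta> where "\<beta> y t = \<zeta> (y t)" for y :: "real \<Rightarrow> real^2" and t :: real
    have \<beta>: "\<beta> \<in> strategies T Y Z t0"
    proof (rule strategiesI)
      show "bdd_meas t0 T RZ (\<beta> y)" if "bdd_meas t0 T RY y" for y
        using that \<zeta> measurable_compose[OF _ \<zeta>(1), of y "lebesgue_on {t0..T}"]
        unfolding bdd_meas_def \<beta>_def[abs_def] by (auto simp: Z)
      show "AE s in lebesgue_on {t0..t}. \<beta> y s = \<beta> y' s" if "AE s in lebesgue_on {t0..t}. y s = y' s" for t y y'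
        using that by eventually_elim (simp add: \<beta>_def)
    qed
    obtain h where h: "0 < h" "t0 + h \<le> T"
      and hV: "\<And>z. bdd_meas t0 T RZ z \<Longrightarrow> V (t0 + h) (trj t0 x0 z (t0 + h)) \<le> \<psi> (t0 + h) (trj t0 x0 z (t0 + h))"
      and h\<psi>: "\<And>z. bdd_meas t0 T RZ z \<Longrightarrow> \<bar>\<psi> (t0 + h) (trj t0 x0 z (t0 + h)) - \<psi> t0 x0 - q * h
        + integral {t0..t0 + h} (\<lambda>s. p \<bullet> z s)\<bar> \<le> \<theta> * h"
      and hF: "\<And>y z s. bdd_meas t0 T RY y \<Longrightarrow> bdd_meas t0 T RZ z \<Longrightarrow> s \<in> {t0..t0 + h} \<Longrightarrow>
        \<bar>F s (trj t0 x0 z s) (y s) (z s) - F t0 x0 (y s) (z s)\<bar> \<le> \<theta>"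
      unfolding q_def p_def using local_expansion[OF \<psi> t0 \<theta> le] by blast
    have "V t0 x0 \<le> \<psi> t0 x0 - \<theta> * h"
    proof (rule DPP_le[OF \<beta> t0'(2) _ h(2)])
      show "t0 \<le> t0 + h" using h by simp
      fix y assume y: "bdd_meas t0 T RY y"
      let ?z = "\<beta> y" and ?x = "trj t0 x0 (\<beta> y)"
      have z: "bdd_meas t0 T RZ ?z" by (rule strategy_bdd_meas[OF \<beta> y])
      have yh: "bdd_meas t0 (t0 + h) RY y" and zh: "bdd_meas t0 (t0 + h) RZ ?z"
        by (rule bdd_meas_subset[OF y] bdd_meas_subset[OF z]; use h in auto)+
      have pz: "(\<lambda>s. p \<bullet> ?z s) integrable_on {t0..t0 + h}"
        using inner_control_integral[OF zh] by (rule has_integral_integrable)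
      have "run t0 (t0 + h) x0 y ?z \<le> integral {t0..t0 + h} (\<lambda>s. p \<bullet> ?z s + (- q - 2 * \<theta>))"
        unfolding run_def
      proof (rule integral_le)
        show "(\<lambda>t. F t (?x t) (y t) (?z t)) integrable_on {t0..t0 + h}"
          by (rule F_trj_integrable_on[OF yh zh]) (use t0' h in auto)
        show "(\<lambda>s. p \<bullet> ?z s + (- q - 2 * \<theta>)) integrable_on {t0..t0 + h}"
          by (intro integrable_add pz) auto
        fix s assume s: "s \<in> {t0..t0 + h}"
        show "F s (?x s) (y s) (?z s) \<le> p \<bullet> ?z s + (- q - 2 * \<theta>)"
          using hF[OF y z s] \<zeta>c[OF bdd_meas_Y[OF yh s]] by (simp add: \<beta>_def abs_le_iff)
      qed
      also have "\<dots> = integral {t0..t0 + h} (\<lambda>s. p \<bullet> ?z s) + (- q - 2 * \<theta>) * h"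
        using h by (subst integral_add[OF pz]) auto
      finally show "run t0 (t0 + h) x0 y ?z + V (t0 + h) (?x (t0 + h)) \<le> \<psi> t0 x0 - \<theta> * h"
        using hV[OF z] h\<psi>[OF z] by (simp add: algebra_simps abs_le_iff)
    qed
    moreover have "0 < \<theta> * h" using \<theta> h by simp
    ultimately show False using eq by simp
  qed
qed

lemma V_supersolution: "viscosity_supersolution T H g V"
  unfolding viscosity_supersolution_def
proof (intro conjI V_admissible ballI allI impI; elim conjE)
  fix t0 x0 \<psi>
  assume t0: "t0 \<in> {0<..<T}" and \<psi>: "Gamma1 T \<psi>" and eq: "V t0 x0 = \<psi> t0 x0"
    and ge: "\<forall>\<^sub>F (t, x) in nhds (t0, x0). \<psi> t x \<le> V t x"
  define q where "q = deriv (\<lambda>t. \<psi> t x0) t0"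
  define p where "p = grad_H (\<psi> t0) x0"
  have t0': "t0 \<in> {0..T}" "0 \<le> t0" using t0 by auto
  show "deriv (\<lambda>t. \<psi> t x0) t0 + H t0 x0 (grad_H (\<psi> t0) x0) \<le> 0"
  proof (rule ccontr)
    assume "\<not> ?thesis"
    then have pos: "0 < q + H t0 x0 p" by (simp add: q_def p_def)
    \<comment> \<open>Again a margin of \<open>4 * \<theta>\<close>, with three parts spent as
      before; the remaining \<open>\<theta> * h\<close> exceeds the loss
      \<open>\<theta> * h / 2\<close> of a nearly optimal strategy.\<close>
    define \<theta> where "\<theta> = (q + H t0 x0 p) / 4"
    have \<theta>: "0 < \<theta>" using pos by (simp add: \<theta>_def)
    have "- q + 3 * \<theta> < H t0 x0 p" using pos unfolding \<theta>_def by argo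
    from H_greater[OF t0'(1) this] obtain c where c: "c \<in> Y"
      and cF: "\<And>z. z \<in> Z \<Longrightarrow> - q + 3 * \<theta> < F t0 x0 c z - p \<bullet> z" by blast
    obtain h where h: "0 < h" "t0 + h \<le> T"
      and hV: "\<And>z. bdd_meas t0 T RZ z \<Longrightarrow> \<psi> (t0 + h) (trj t0 x0 z (t0 + h)) \<le> V (t0 + h) (trj t0 x0 z (t0 + h))"
      and h\<psi>: "\<And>z. bdd_meas t0 T RZ z \<Longrightarrow> \<bar>\<psi> (t0 + h) (trj t0 x0 z (t0 + h)) - \<psi> t0 x0 - q * h
        + integral {t0..t0 + h} (\<lambda>s. p \<bullet> z s)\<bar> \<le> \<theta> * h"
      and hF: "\<And>y z s. bdd_meas t0 T RY y \<Longrightarrow> bdd_meas t0 T RZ z \<Longrightarrow> s \<in> {t0..t0 + h} \<Longrightarrow>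
        \<bar>F s (trj t0 x0 z s) (y s) (z s) - F t0 x0 (y s) (z s)\<bar> \<le> \<theta>"
      unfolding q_def p_def using local_expansion[OF \<psi> t0 \<theta> ge] by blast
    have \<theta>h: "0 < \<theta> * h" using \<theta> h by simp
    then have "V t0 x0 < \<psi> t0 x0 + \<theta> * h / 2" using eq by simp
    from DPP_ge[OF this t0'(2) _ h(2)] h(1) obtain \<beta> where \<beta>: "\<beta> \<in> strategies T Y Z t0"
      and b: "\<And>y. bdd_meas t0 T RY y \<Longrightarrow>
        run t0 (t0 + h) x0 y (\<beta> y) + V (t0 + h) (trj t0 x0 (\<beta> y) (t0 + h)) \<le> \<psi> t0 x0 + \<theta> * h / 2" by auto
    \<comment> \<open>The reply \<open>?z\<close> of the unknown strategy is an arbitrary measurable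
      control; the bound on \<open>F t0 x0 c z - p \<bullet> z\<close> holds for each of its
      values.\<close>
    let ?y = "\<lambda>_::real. c"
    let ?z = "\<beta> ?y"
    let ?x = "trj t0 x0 ?z"
    have y: "bdd_meas t0 T RY ?y" by (rule const_control[OF c])
    have z: "bdd_meas t0 T RZ ?z" by (rule strategy_bdd_meas[OF \<beta> y])
    have yh: "bdd_meas t0 (t0 + h) RY ?y" and zh: "bdd_meas t0 (t0 + h) RZ ?z"
      by (rule bdd_meas_subset[OF y] bdd_meas_subset[OF z]; use h in auto)+
    have pz: "(\<lambda>s. p \<bullet> ?z s) integrable_on {t0..t0 + h}"
      using inner_control_integral[OF zh] by (rule has_integral_integrable)
    have "integral {t0..t0 + h} (\<lambda>s. p \<bullet> ?z s) + (- q + 2 * \<theta>) * h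
        = integral {t0..t0 + h} (\<lambda>s. p \<bullet> ?z s + (- q + 2 * \<theta>))"
      using h by (subst integral_add[OF pz]) auto
    also have "\<dots> \<le> run t0 (t0 + h) x0 ?y ?z"
      unfolding run_def
    proof (rule integral_le)
      show "(\<lambda>t. F t (?x t) c (?z t)) integrable_on {t0..t0 + h}"
        by (rule F_trj_integrable_on[OF yh zh]) (use t0' h in auto)
      show "(\<lambda>s. p \<bullet> ?z s + (- q + 2 * \<theta>)) integrable_on {t0..t0 + h}"
        by (intro integrable_add pz) auto
      fix s assume s: "s \<in> {t0..t0 + h}"
      show "p \<bullet> ?z s + (- q + 2 * \<theta>) \<le> F s (?x s) c (?z s)"
        using hF[OF y z s] cF[OF bdd_meas_Z[OF zh s]] by (simp add: abs_le_iff)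
    qed
    finally show False
      using hV[OF z] h\<psi>[OF z] b[OF y] \<theta>h by (simp add: algebra_simps abs_le_iff)
  qed
qed

end

theorem theorem1p2:
  fixes T RY RZ C1 C1' C2 C2' :: real
    and Y Z :: "(real^2) set"
    and F :: "real \<Rightarrow> heis \<Rightarrow> real^2 \<Rightarrow> real^2 \<Rightarrow> real"
    and g :: "heis \<Rightarrow> real"
  assumes "T > 0" and "RY > 0" and "RZ > 0"
    and "Y = {y. norm y \<le> RY}" and "Z = {z. norm z \<le> RZ}"
    and "unif_cont_wrt dist_txyz ({0..T} \<times> UNIV \<times> Y \<times> Z) (\<lambda>(t, x, y, z). F t x y z)"
    and "\<And>t x y z. t \<in> {0..T} \<Longrightarrow> y \<in> Y \<Longrightarrow> z \<in> Z \<Longrightarrow> \<bar>F t x y z\<bar> \<le> C1"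
    and "\<And>t x x' y z. t \<in> {0..T} \<Longrightarrow> y \<in> Y \<Longrightarrow> z \<in> Z \<Longrightarrow>
           \<bar>F t x y z - F t x' y z\<bar> \<le> C1' * dG x x'"
    and "\<And>x. \<bar>g x\<bar> \<le> C2"
    and "\<And>x x'. \<bar>g x - g x'\<bar> \<le> C2' * dG x x'"
  shows "viscosity_solution T (lower_hamiltonian Y Z F) g (lower_value T Y Z F g)"
proof -
  interpret heis_game T RY RZ C1 C1' C2 C2' Y Z F g
    using assms by unfold_locales
  show ?thesis
    unfolding viscosity_solution_def using V_subsolution V_supersolution by blast
qed

end
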